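(* Let $(T,\preceq,\Sigma,\mathcal S,\mathcal M)$ be an $(\mathcal S,\mathcal M)$-tree. Then for every pair $n,k\in\omega$ and every colouring $\chi$ of $\mathcal{AM}^n_k$ with finitely many colours, there exists $F\in\mathcal M^n$ such that $\chi$ is constant on $\{F\circ g: g\in\mathcal{AM}^n_k\}$.
   Context: A tree is a partially ordered set $(T,\preceq)$ such that for every $a\in T$ the set $\{b\in T:b\prec a\}$ is finite and linearly ordered by $\preceq$. The level of $a$ is $\ell(a)=|\{b\in T:b\prec a\}|$; $T(n)=\{a\in T:\ell(a)=n\}$, and $T(\le n)$, $T(<n)$ are defined analogously. For $a\in T$ and $n\le \ell(a)$, $a|_n$ denotes the unique predecessor of $a$ at level $n$ (with $a|_{\ell(a)}=a$). A node $b$ is an immediate successor of $a$ if $a\prec b$ and there is no $c$ with $a\prec c\prec b$. An $\mathcal S$-tree is a quadruple $(T,\preceq,\Sigma,\mathcal S)$ where $(T,\preceq)$ is a countable tree in which every node has finitely many immediate successors and $T(0)$ is finite, $\Sigma$ is a set, and $\mathcal S\colon T\times T^{<\omega}\times\Sigma\to T$ is a partial function such that: (S1) if $\mathcal S(a,\bar p,c)$ is defined then it is an immediate successor of $a$ and every entry of $\bar p$ has level at most $\ell(a)-1$; (S2) if $\mathcal S(a,\bar p,c)=\mathcal S(b,\bar q,d)$ then $a=b$, $\bar p=\bar q$ and $c=d$; (S3) for every $a\in T$ and every immediate successor $b$ of $a$ there are $\bar p\in T^{<\omega}$ and $c\in\Sigma$ with $b=\mathcal S(a,\bar p,c)$.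 For $S\subseteq T$, a map $f\colon S\to T$ is level-preserving if $\ell(a)=\ell(b)$ implies $\ell(f(a))=\ell(f(b))$; then $\tilde f(n)$ denotes $\ell(f(a))$ for any $a\in S$ with $\ell(a)=n$. An injection $F\colon T\to T$ is shape-preserving if (i) it is level-preserving; (ii) whenever $\mathcal S(a,\bar p,c)$ is defined, $\mathcal S(F(a),F(\bar p),c)$ is defined and $\mathcal S(F(a),F(\bar p),c)\preceq F(\mathcal S(a,\bar p,c))$, where $F(\bar p)$ is the tuple of images of the entries of $\bar p$; (iii) for every $a\in T(0)$ and $b\in T$ with $a\preceq b$ we have $a\preceq F(b)$. For $S\subseteq T$, a map $f\colon S\to T$ is shape-preserving if it extends to a shape-preserving $F\colon T\to T$. A shape-preserving $F$ skips level $m$ if $m\notin\tilde F[\omega]$, and skips only level $m$ if $\tilde F[\omega]=\omega\setminus\{m\}$. An $(\mathcal S,\mathcal M)$-tree is a quintuple $(T,\preceq,\Sigma,\mathcal S,\mathcal M)$ where $(T,\preceq,\Sigma,\mathcal S)$ is an $\mathcal S$-tree and $\mathcal M$ is a set of shape-preserving functions $T\to T$ such that: (M1) $\mathrm{Id}_T\in\mathcal M$, $\mathcal M$ is closed under composition, and whenever $(F_i)_{i\in\omega}$ is a sequence in $\mathcal M$ with $F_i\restriction T(\le i)=F_{i+1}\restriction T(\le i)$ for all $i$, there is $F_\infty\in\mathcal M$ with $F_\infty\restriction T(\le i)=F_i\restriction T(\le i)$ for all $i$; (M2) for every $n\in\omega$ and every $F\in\mathcal M$ with $\tilde F(n)>0$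 which skips level $\tilde F(n)-1$, there are $F_1,F_2\in\mathcal M$ such that $F_2$ skips only level $\tilde F(n)-1$ and $(F_2\circ F_1)\restriction T(\le n)=F\restriction T(\le n)$; (M3) for all $n<m$ in $\omega$ there is $F^n_m\in\mathcal M$ skipping only level $m$ such that $F^n_m(b)=\mathcal S(b,\bar p,c)$ whenever $a\in T(n)$, $b\in T(m)$, $\bar p\in T^{<\omega}$, $c\in\Sigma$, $\mathcal S(a,\bar p,c)$ is defined and $\mathcal S(a,\bar p,c)\preceq b$. Notation: $\mathcal M^n=\{F\in\mathcal M: F\restriction T(<n)\text{ is the identity}\}$; $\mathcal{AM}=\{F\restriction T(<k): F\in\mathcal M,\ k>0\}$; $\mathcal{AM}^n_k=\{F\restriction T(<n+k):F\in\mathcal M^n\}$; $\mathcal{AM}^n_k(\le m)=\{f\in\mathcal{AM}^n_k:\tilde f(n+k-1)\le m\}$; $\mathcal{AM}^n_k(m)=\{f\in\mathcal{AM}^n_k:\tilde f(n+k-1)=m\}$. *)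

theory Defs
  imports Main "HOL-Library.Countable_Set" "HOL-Library.FuncSet"
begin

text \<open>A tree is given by a carrier set T and a relation le (written as a preorder
  symbol in the paper).  Maps T \<rightarrow> T are represented as HOL functions that are
  extensional on T (value undefined outside T); partial maps S \<rightarrow> T, S \<subseteq> T, are
  represented by restrict.\<close>

definition tlt :: "('a \<Rightarrow> 'a \<Rightarrow> bool) \<Rightarrow> 'a \<Rightarrow> 'a \<Rightarrow> bool" where
  "tlt le a b \<longleftrightarrow> le a b \<and> a \<noteq> b"

definition is_tree :: "'a set \<Rightarrow> ('a \<Rightarrow> 'a \<Rightarrow> bool) \<Rightarrow> bool" where
  "is_tree T le \<longleftrightarrow>
     (\<forall>a\<in>T. le a a) \<and>
     (\<forall>a\<in>T. \<forall>b\<in>T. le a b \<and> le b a \<longrightarrow> a = b) \<and>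
     (\<forall>a\<in>T. \<forall>b\<in>T. \<forall>c\<in>T. le a b \<and> le b c \<longrightarrow> le a c) \<and>
     (\<forall>a\<in>T. finite {b\<in>T. tlt le b a} \<and>
        (\<forall>b\<in>{b\<in>T. tlt le b a}. \<forall>c\<in>{b\<in>T. tlt le b a}. le b c \<or> le c b))"

definition level :: "'a set \<Rightarrow> ('a \<Rightarrow> 'a \<Rightarrow> bool) \<Rightarrow> 'a \<Rightarrow> nat" where
  "level T le a = card {b\<in>T. tlt le b a}"

definition Tlev :: "'a set \<Rightarrow> ('a \<Rightarrow> 'a \<Rightarrow> bool) \<Rightarrow> nat \<Rightarrow> 'a set" where
  "Tlev T le n = {a\<in>T. level T le a = n}"

definition Tle :: "'a set \<Rightarrow> ('a \<Rightarrow> 'a \<Rightarrow> bool) \<Rightarrow> nat \<Rightarrow> 'a set" where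
  "Tle T le n = {a\<in>T. level T le a \<le> n}"

definition Tlt :: "'a set \<Rightarrow> ('a \<Rightarrow> 'a \<Rightarrow> bool) \<Rightarrow> nat \<Rightarrow> 'a set" where
  "Tlt T le n = {a\<in>T. level T le a < n}"

definition imm_succ :: "'a set \<Rightarrow> ('a \<Rightarrow> 'a \<Rightarrow> bool) \<Rightarrow> 'a \<Rightarrow> 'a \<Rightarrow> bool" where
  "imm_succ T le a b \<longleftrightarrow> a \<in> T \<and> b \<in> T \<and> tlt le a b \<and>
     \<not> (\<exists>c\<in>T. tlt le a c \<and> tlt le c b)"

definition S_tree :: "'a set \<Rightarrow> ('a \<Rightarrow> 'a \<Rightarrow> bool) \<Rightarrow> 'b set \<Rightarrow> ('a \<Rightarrow> 'a list \<Rightarrow> 'b \<Rightarrow> 'a option) \<Rightarrow> bool" where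
  "S_tree T le Sig S \<longleftrightarrow>
     is_tree T le \<and> countable T \<and>
     (\<forall>a\<in>T. finite {b. imm_succ T le a b}) \<and>
     finite (Tlev T le 0) \<and>
     (\<forall>a p c x. S a p c = Some x \<longrightarrow> a \<in> T \<and> set p \<subseteq> T \<and> c \<in> Sig \<and> x \<in> T) \<and>
     (\<forall>a p c x. S a p c = Some x \<longrightarrow>
        imm_succ T le a x \<and> (\<forall>q\<in>set p. level T le q + 1 \<le> level T le a)) \<and>
     (\<forall>a p c b q d x. S a p c = Some x \<and> S b q d = Some x \<longrightarrow> a = b \<and> p = q \<and> c = d) \<and>
     (\<forall>a\<in>T. \<forall>b. imm_succ T le a b \<longrightarrow> (\<exists>p c. set p \<subseteq> T \<and> c \<in> Sig \<and> S a p c = Some b))"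

definition level_preserving :: "'a set \<Rightarrow> ('a \<Rightarrow> 'a \<Rightarrow> bool) \<Rightarrow> 'a set \<Rightarrow> ('a \<Rightarrow> 'a) \<Rightarrow> bool" where
  "level_preserving T le A f \<longleftrightarrow>
     (\<forall>a\<in>A. \<forall>b\<in>A. level T le a = level T le b \<longrightarrow> level T le (f a) = level T le (f b))"

definition ftilde :: "'a set \<Rightarrow> ('a \<Rightarrow> 'a \<Rightarrow> bool) \<Rightarrow> 'a set \<Rightarrow> ('a \<Rightarrow> 'a) \<Rightarrow> nat \<Rightarrow> nat" where
  "ftilde T le A f n = level T le (f (SOME a. a \<in> A \<and> level T le a = n))"

definition level_image :: "'a set \<Rightarrow> ('a \<Rightarrow> 'a \<Rightarrow> bool) \<Rightarrow> ('a \<Rightarrow> 'a) \<Rightarrow> nat set" where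
  "level_image T le F = {ftilde T le T F n | n. Tlev T le n \<noteq> {}}"

definition skips :: "'a set \<Rightarrow> ('a \<Rightarrow> 'a \<Rightarrow> bool) \<Rightarrow> ('a \<Rightarrow> 'a) \<Rightarrow> nat \<Rightarrow> bool" where
  "skips T le F m \<longleftrightarrow> m \<notin> level_image T le F"

definition skips_only :: "'a set \<Rightarrow> ('a \<Rightarrow> 'a \<Rightarrow> bool) \<Rightarrow> ('a \<Rightarrow> 'a) \<Rightarrow> nat \<Rightarrow> bool" where
  "skips_only T le F m \<longleftrightarrow> level_image T le F = UNIV - {m}"

definition shape_preserving ::
  "'a set \<Rightarrow> ('a \<Rightarrow> 'a \<Rightarrow> bool) \<Rightarrow> ('a \<Rightarrow> 'a list \<Rightarrow> 'b \<Rightarrow> 'a option) \<Rightarrow> ('a \<Rightarrow> 'a) \<Rightarrow> bool" where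
  "shape_preserving T le S F \<longleftrightarrow>
     F \<in> T \<rightarrow> T \<and> inj_on F T \<and>
     level_preserving T le T F \<and>
     (\<forall>a p c x. S a p c = Some x \<longrightarrow>
        (\<exists>y. S (F a) (map F p) c = Some y \<and> le y (F x))) \<and>
     (\<forall>a\<in>Tlev T le 0. \<forall>b\<in>T. le a b \<longrightarrow> le a (F b))"

definition SM_tree ::
  "'a set \<Rightarrow> ('a \<Rightarrow> 'a \<Rightarrow> bool) \<Rightarrow> 'b set \<Rightarrow> ('a \<Rightarrow> 'a list \<Rightarrow> 'b \<Rightarrow> 'a option)
    \<Rightarrow> ('a \<Rightarrow> 'a) set \<Rightarrow> bool" where
  "SM_tree T le Sig S M \<longleftrightarrow>
     S_tree T le Sig S \<and>
     (\<forall>F\<in>M. shape_preserving T le S F \<and> F \<in> extensional T) \<and>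
     \<comment> \<open>(M1)\<close>
     restrict id T \<in> M \<and>
     (\<forall>F\<in>M. \<forall>G\<in>M. compose T G F \<in> M) \<and>
     (\<forall>Fs :: nat \<Rightarrow> 'a \<Rightarrow> 'a. (\<forall>i. Fs i \<in> M) \<longrightarrow>
        (\<forall>i. \<forall>x\<in>Tle T le i. Fs i x = Fs (Suc i) x) \<longrightarrow>
        (\<exists>F\<in>M. \<forall>i. \<forall>x\<in>Tle T le i. F x = Fs i x)) \<and>
     \<comment> \<open>(M2)\<close>
     (\<forall>n. \<forall>F\<in>M. Tlev T le n \<noteq> {} \<longrightarrow> ftilde T le T F n > 0 \<longrightarrow>
        skips T le F (ftilde T le T F n - 1) \<longrightarrow>
        (\<exists>F1\<in>M. \<exists>F2\<in>M. skips_only T le F2 (ftilde T le T F n - 1) \<and>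
            (\<forall>x\<in>Tle T le n. F2 (F1 x) = F x))) \<and>
     \<comment> \<open>(M3)\<close>
     (\<forall>n m. n < m \<longrightarrow>
        (\<exists>F\<in>M. skips_only T le F m \<and>
           (\<forall>a\<in>Tlev T le n. \<forall>b\<in>Tlev T le m. \<forall>p c x.
              S a p c = Some x \<and> le x b \<longrightarrow> S b p c = Some (F b))))"

definition Mn :: "'a set \<Rightarrow> ('a \<Rightarrow> 'a \<Rightarrow> bool) \<Rightarrow> ('a \<Rightarrow> 'a) set \<Rightarrow> nat \<Rightarrow> ('a \<Rightarrow> 'a) set" where
  "Mn T le M n = {F\<in>M. \<forall>x\<in>Tlt T le n. F x = x}"

definition AMnk :: "'a set \<Rightarrow> ('a \<Rightarrow> 'a \<Rightarrow> bool) \<Rightarrow> ('a \<Rightarrow> 'a) set \<Rightarrow> nat \<Rightarrow> nat \<Rightarrow> ('a \<Rightarrow> 'a) set" where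
  "AMnk T le M n k = (\<lambda>F. restrict F (Tlt T le (n + k))) ` Mn T le M n"

end

theory Submission
  imports Defs
begin

text \<open>The maps fixing \<open>T(<n)\<close> form a monoid \<open>M\<^sup>n\<close>, and by (M2) every \<open>F \<in> M\<close> that extends a
  finite approximation \<open>f\<close> factors on the next level as \<open>Y \<circ> f\<close>, where \<open>Y\<close> fixes everything
  below the image of \<open>f\<close>. A property of elements of \<open>M\<^sup>n\<close>, seen on \<open>T(\<le>n)\<close>, is called large if it
  is met by every subspace \<open>F \<circ> M\<^sup>n\<close>. One of finitely many colours is large on a subspace, and a
  large property holds on a whole subspace. As in Baumgartner's proof of Hindman's theorem, the
  latter follows by fusion once every large property is shown to contain a point \<open>F\<close> such that
  the extensions of all \<open>F \<circ> u\<close>, with \<open>u\<close> ending one level up, stay in the property for a large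
  set of extensions. If \<open>F\<close> itself need not lie in the property, the Hales--Jewett theorem, applied to
  words whose letters are copied to higher levels by (M3), provides such an \<open>F\<close>; iterating this and
  using largeness once more puts \<open>F\<close> in the property. This settles \<open>k = 1\<close>; general \<open>k\<close> follows by
  making the colour independent of the last level.\<close>

section \<open>The Hales--Jewett theorem\<close>

text \<open>As seen on T(\<le>N), there are in general several steps from level N to level N + 1,
  but only finitely many, and a line has to serve all of them at once. This calls for an arbitrary
  finite alphabet, with one letter for each step. Properties of a composite
  \<open>H \<Zsemi> h \<Zsemi> X \<Zsemi> g\<close> are tested on T(\<le>n), where \<open>g\<close>
  acts before everything else, while new choices have to be made above the levels already placed by
  \<open>X\<close>. A fusion state is therefore a pair: \<open>X\<close> places the levels decided
  so far, \<open>H\<close> collects the subspaces passed to, and the future \<open>h\<close> goes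
  between them, fixing all nodes below the level where \<open>X\<close> puts the current one. Going
  from one stage to the next means moving a step \<open>u\<close> on the right of \<open>X\<close>
  to a step \<open>v\<close> on its left. For \<open>v\<close> to climb exactly as far as
  \<open>u\<close>, the map \<open>X\<close> must skip nothing from the relevant level on; hence the
  notion \<open>tight\<close>.\<close>

definition words :: "nat \<Rightarrow> nat \<Rightarrow> nat list set" where
  "words s L = {w. set w \<subseteq> {..<s} \<and> length w = L}"

definition var_words :: "nat \<Rightarrow> nat \<Rightarrow> nat option list set" where
  "var_words s L = {w. set w \<subseteq> insert None (Some ` {..<s}) \<and> length w = L \<and> None \<in> set w}"

definition subst_word :: "nat \<Rightarrow> nat option list \<Rightarrow> nat list" where
  "subst_word j w = map (case_option j id) w"

lemma finite_words: "finite (words s L)"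
  unfolding words_def by (rule finite_lists_length_eq) simp

lemma finite_var_words: "finite (var_words s L)"
  by (rule finite_subset[OF _ finite_lists_length_eq[of "insert None (Some ` {..<s})" L]])
    (auto simp: var_words_def)

lemma subst_word_in_words: "w \<in> var_words s L \<Longrightarrow> j < s \<Longrightarrow> subst_word j w \<in> words s L"
  by (fastforce simp: var_words_def words_def subst_word_def)

lemma subst_word_map_Some [simp]: "subst_word j (map Some u) = u"
  by (simp add: subst_word_def comp_def)

lemma subst_word_append [simp]: "subst_word j (u @ v) = subst_word j u @ subst_word j v"
  by (simp add: subst_word_def)

lemma words_append: "u \<in> words s L \<Longrightarrow> v \<in> words s K \<Longrightarrow> u @ v \<in> words s (L + K)"
  by (auto simp: words_def)

lemma words_mono: "s \<le> t \<Longrightarrow> words s L \<subseteq> words t L"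
  by (fastforce simp: words_def)

lemma var_words_mono: "s \<le> t \<Longrightarrow> var_words s L \<subseteq> var_words t L"
  by (fastforce simp: var_words_def)

lemma var_words_append:
  "u \<in> var_words s L \<Longrightarrow> v \<in> var_words s K \<Longrightarrow> u @ v \<in> var_words s (L + K)"
  "u \<in> var_words s L \<Longrightarrow> b \<in> words s K \<Longrightarrow> u @ map Some b \<in> var_words s (L + K)"
  "a \<in> words s L \<Longrightarrow> v \<in> var_words s K \<Longrightarrow> map Some a @ v \<in> var_words s (L + K)"
  by (auto simp: var_words_def words_def)

definition monochromatic :: "nat \<Rightarrow> (nat list \<Rightarrow> nat) \<Rightarrow> nat option list \<Rightarrow> nat \<Rightarrow> bool" where
  "monochromatic s \<chi> w c \<longleftrightarrow> (\<forall>j<s. \<chi> (subst_word j w) = c)"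

text \<open>Colour focusing: lines that are monochromatic away from the letter \<open>s\<close>, with distinct
  colours, and that all pass through the same word \<open>f\<close> at that letter.\<close>

lemma hales_jewett_focus:
  assumes HJ: "\<And>r. \<exists>L. \<forall>\<chi>. \<chi> ` words s L \<subseteq> {..<r} \<longrightarrow> (\<exists>w\<in>var_words s L. \<exists>c. monochromatic s \<chi> w c)"
    and s: "0 < s"
  shows "\<exists>L. \<forall>\<chi>. \<chi> ` words (Suc s) L \<subseteq> {..<r} \<longrightarrow>
    (\<exists>w\<in>var_words (Suc s) L. \<exists>c. monochromatic (Suc s) \<chi> w c) \<or>
    (\<exists>f\<in>words (Suc s) L. \<exists>C. finite C \<and> card C = q \<and>
      (\<forall>c\<in>C. \<exists>w\<in>var_words (Suc s) L. subst_word s w = f \<and> monochromatic s \<chi> w c))"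
proof (induction q)
  case 0
  show ?case
    by (intro exI[of _ 0] allI impI disjI2 bexI[of _ "[]"] exI[of _ "{}"]) (auto simp: words_def)
next
  case (Suc q)
  then obtain L where L: "\<And>\<chi>. \<chi> ` words (Suc s) L \<subseteq> {..<r} \<Longrightarrow>
    (\<exists>w\<in>var_words (Suc s) L. \<exists>c. monochromatic (Suc s) \<chi> w c) \<or>
    (\<exists>f\<in>words (Suc s) L. \<exists>C. finite C \<and> card C = q \<and>
      (\<forall>c\<in>C. \<exists>w\<in>var_words (Suc s) L. subst_word s w = f \<and> monochromatic s \<chi> w c))"
    by blast
  \<comment> \<open>The row of a suffix \<open>v\<close> records the colours of \<open>u @ v\<close>
    for all prefixes \<open>u\<close>. Rows are the colours to which \<open>HJ\<close> is applied,
    so that one line of suffixes works for every prefix at once.\<close>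
  let ?E = "words (Suc s) L \<rightarrow>\<^sub>E {..<r}"
  have "finite ?E" using finite_words by (intro finite_PiE) auto
  then obtain enc where enc: "bij_betw enc ?E {0..<card ?E}" using ex_bij_betw_finite_nat by blast
  obtain K where K: "\<And>\<chi>. \<chi> ` words s K \<subseteq> {..<card ?E} \<Longrightarrow> \<exists>w\<in>var_words s K. \<exists>c. monochromatic s \<chi> w c"
    using HJ[of "card ?E"] by blast
  show ?case
  proof (intro exI[of _ "L + K"] allI impI)
    fix \<chi> assume \<chi>: "\<chi> ` words (Suc s) (L + K) \<subseteq> {..<r}"
    let ?row = "\<lambda>v. restrict (\<lambda>u. \<chi> (u @ v)) (words (Suc s) L)"
    have row: "?row v \<in> ?E" if "v \<in> words s K" for v
    proof -
      have "v \<in> words (Suc s) K" using that words_mono[of s "Suc s"] by auto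
      then show ?thesis using words_append[of _ "Suc s" L v K] \<chi> by auto
    qed
    have "(\<lambda>v. enc (?row v)) ` words s K \<subseteq> {..<card ?E}"
      using row bij_betwE[OF enc] by fastforce
    then obtain v c where v: "v \<in> var_words s K" "monochromatic s (\<lambda>v. enc (?row v)) v c"
      using K[of "\<lambda>v. enc (?row v)"] by blast
    \<comment> \<open>Only letters below \<open>s\<close> are covered: the line \<open>v\<close>
      comes from the hypothesis on \<open>s\<close> letters, which says nothing about the row at the
      letter \<open>s\<close>.\<close>
    have indep: "\<chi> (u @ subst_word j v) = \<chi> (u @ subst_word 0 v)"
      if "j < s" "u \<in> words (Suc s) L" for u j
    proof -
      have "enc (?row (subst_word j v)) = enc (?row (subst_word 0 v))"
        using v(2) s that(1) by (simp add: monochromatic_def)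
      then have "?row (subst_word j v) = ?row (subst_word 0 v)"
        using bij_betw_imp_inj_on[OF enc] row[OF subst_word_in_words[OF v(1)]] s that(1)
        by (meson inj_onD)
      then show ?thesis using that(2) by (metis (no_types, lifting) restrict_apply')
    qed
    define \<chi>' where "\<chi>' u = \<chi> (u @ subst_word 0 v)" for u
    have v0: "subst_word 0 v \<in> words (Suc s) K"
      using subst_word_in_words[OF v(1) s] words_mono[of s "Suc s" K] by auto
    have v': "v \<in> var_words (Suc s) K" using v(1) var_words_mono[of s "Suc s" K] by auto
    have "\<chi>' ` words (Suc s) L \<subseteq> {..<r}"
      using \<chi> words_append[OF _ v0] by (auto simp: \<chi>'_def)
    from L[OF this]
    show "(\<exists>w\<in>var_words (Suc s) (L + K). \<exists>c. monochromatic (Suc s) \<chi> w c) \<or>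
      (\<exists>f\<in>words (Suc s) (L + K). \<exists>C. finite C \<and> card C = Suc q \<and>
        (\<forall>c\<in>C. \<exists>w\<in>var_words (Suc s) (L + K). subst_word s w = f \<and> monochromatic s \<chi> w c))"
    proof (elim disjE bexE exE conjE)
      fix w c assume w: "w \<in> var_words (Suc s) L" "monochromatic (Suc s) \<chi>' w c"
      have "w @ map Some (subst_word 0 v) \<in> var_words (Suc s) (L + K)"
        by (rule var_words_append(2)[OF w(1) v0])
      moreover have "monochromatic (Suc s) \<chi> (w @ map Some (subst_word 0 v)) c"
        using w(2) by (simp add: monochromatic_def \<chi>'_def)
      ultimately show ?thesis by blast
    next
      fix f C
      assume f: "f \<in> words (Suc s) L" and C: "finite C" "card C = q"
        "\<forall>c\<in>C. \<exists>w\<in>var_words (Suc s) L. subst_word s w = f \<and> monochromatic s \<chi>' w c"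
      show ?thesis
      proof (cases "\<chi>' f \<in> C")
        \<comment> \<open>The focus already has the colour of one of its lines, so this line remains
          monochromatic when the letter \<open>s\<close> is added.\<close>
        case True
        then obtain w where w: "w \<in> var_words (Suc s) L" "subst_word s w = f" "monochromatic s \<chi>' w (\<chi>' f)"
          using C(3) by blast
        have "w @ map Some (subst_word 0 v) \<in> var_words (Suc s) (L + K)"
          by (rule var_words_append(2)[OF w(1) v0])
        moreover have "monochromatic (Suc s) \<chi> (w @ map Some (subst_word 0 v)) (\<chi>' f)"
          using w(2,3) by (auto simp: monochromatic_def \<chi>'_def less_Suc_eq)
        ultimately show ?thesis by blast
      next
        case False
        \<comment> \<open>The focus moves to the letter \<open>s\<close> of \<open>v\<close>. Old
          lines receive \<open>v\<close> as a moving suffix; the constant \<open>f\<close> followed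
          by \<open>v\<close> is a new line, whose colour \<open>\<chi>' f\<close> is not yet in
          \<open>C\<close>.\<close>
        let ?f = "f @ subst_word s v"
        have "\<exists>w\<in>var_words (Suc s) (L + K). subst_word s w = ?f \<and> monochromatic s \<chi> w c"
          if "c \<in> insert (\<chi>' f) C" for c
        proof (cases "c = \<chi>' f")
          case True
          have "monochromatic s \<chi> (map Some f @ v) c"
            unfolding monochromatic_def True \<chi>'_def subst_word_append subst_word_map_Some
            by (intro allI impI indep[OF _ f])
          then show ?thesis using var_words_append(3)[OF f v']
            by (intro bexI[of _ "map Some f @ v"]) auto
        next
          case False
          then have "c \<in> C" using that by simp
          then obtain w where w: "w \<in> var_words (Suc s) L" "subst_word s w = f" "monochromatic s \<chi>' w c"
            using C(3) by blast
          have "monochromatic s \<chi> (w @ v) c"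
            unfolding monochromatic_def
          proof (intro allI impI)
            fix j assume j: "j < s"
            have "\<chi> (subst_word j w @ subst_word j v) = \<chi>' (subst_word j w)"
              unfolding \<chi>'_def using j subst_word_in_words[OF w(1), of j] by (intro indep) auto
            then show "\<chi> (subst_word j (w @ v)) = c"
              using w(3) j by (simp add: monochromatic_def)
          qed
          then show ?thesis using var_words_append(1)[OF w(1) v'] w(2)
            by (intro bexI[of _ "w @ v"]) auto
        qed
        moreover have "?f \<in> words (Suc s) (L + K)"
          using words_append[OF f subst_word_in_words[OF v']] by simp
        moreover have "finite (insert (\<chi>' f) C)" "card (insert (\<chi>' f) C) = Suc q"
          using C False by auto
        ultimately show ?thesis by blast
      qed
    qed
  qed
qed

text \<open>Induction on the alphabet. With \<open>r\<close> focused lines every colour occurs, so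
  the focus repeats one of them. One letter is treated apart, since a line has a definite colour
  away from the letter \<open>s\<close> only if \<open>s > 0\<close>.\<close>

theorem hales_jewett:
  "\<exists>L. \<forall>\<chi>. \<chi> ` words s L \<subseteq> {..<r} \<longrightarrow> (\<exists>w\<in>var_words s L. \<exists>c. monochromatic s \<chi> w c)"
proof (induction s arbitrary: r)
  case 0
  show ?case
    by (intro exI[of _ 1] allI impI bexI[of _ "[None]"]) (auto simp: var_words_def monochromatic_def)
next
  case (Suc s)
  show ?case
  proof (cases "s = 0")
    case True
    have "[None] \<in> var_words (Suc s) 1" by (simp add: var_words_def)
    moreover have "monochromatic (Suc s) \<chi> [None] (\<chi> (subst_word 0 [None]))" for \<chi>
      using True by (simp add: monochromatic_def)
    ultimately show ?thesis by blast
  next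
    case False
    then obtain L where L: "\<And>\<chi>. \<chi> ` words (Suc s) L \<subseteq> {..<r} \<Longrightarrow>
      (\<exists>w\<in>var_words (Suc s) L. \<exists>c. monochromatic (Suc s) \<chi> w c) \<or>
      (\<exists>f\<in>words (Suc s) L. \<exists>C. finite C \<and> card C = r \<and>
        (\<forall>c\<in>C. \<exists>w\<in>var_words (Suc s) L. subst_word s w = f \<and> monochromatic s \<chi> w c))"
      using hales_jewett_focus[OF Suc.IH, of r r] by auto
    show ?thesis
    proof (intro exI[of _ L] allI impI)
      fix \<chi> assume \<chi>: "\<chi> ` words (Suc s) L \<subseteq> {..<r}"
      from L[OF this] show "\<exists>w\<in>var_words (Suc s) L. \<exists>c. monochromatic (Suc s) \<chi> w c"
      proof (elim disjE bexE exE conjE)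
        fix f C
        assume f: "f \<in> words (Suc s) L" and C: "finite C" "card C = r"
          "\<forall>c\<in>C. \<exists>w\<in>var_words (Suc s) L. subst_word s w = f \<and> monochromatic s \<chi> w c"
        have "C \<subseteq> {..<r}"
        proof
          fix c assume "c \<in> C"
          then obtain w where w: "w \<in> var_words (Suc s) L" "monochromatic s \<chi> w c" using C(3) by blast
          then have "c = \<chi> (subst_word 0 w)" using False by (simp add: monochromatic_def)
          then show "c \<in> {..<r}" using \<chi> subst_word_in_words[OF w(1), of 0] by auto
        qed
        then have "C = {..<r}" using C card_subset_eq[of "{..<r}" C] by simp
        then have "\<chi> f \<in> C" using \<chi> f by auto
        then obtain w where w: "w \<in> var_words (Suc s) L" "subst_word s w = f" "monochromatic s \<chi> w (\<chi> f)"
          using C(3) by blast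
        then have "monochromatic (Suc s) \<chi> w (\<chi> f)"
          by (auto simp: monochromatic_def less_Suc_eq)
        then show ?thesis using w(1) by blast
      qed blast
    qed
  qed
qed

section \<open>Trees and shape-preserving maps\<close>

lemma strict_mono_nat_eq_of_range_eq:
  fixes f g :: "nat \<Rightarrow> nat"
  assumes f: "strict_mono f" and g: "strict_mono g" and eq: "range f = range g"
  shows "f i = g i"
proof (induction i rule: less_induct)
  case (less i)
  have le: "h' i \<le> h i" if h: "strict_mono h" "strict_mono h'" "h i \<in> range h'"
    and IH: "\<And>j. j < i \<Longrightarrow> h j = h' j" for h h' :: "nat \<Rightarrow> nat"
  proof -
    from h(3) obtain j where j: "h i = h' j" by blast
    have "\<not> j < i"
    proof
      assume "j < i"
      then have "h i = h j" using IH j by metis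
      then show False using strict_monoD[OF h(1) \<open>j < i\<close>] by simp
    qed
    then show ?thesis using j h(2) by (simp add: strict_mono_less_eq)
  qed
  have "f i \<in> range g" "g i \<in> range f" using eq by auto
  then have "g i \<le> f i" "f i \<le> g i" using le[OF f g] le[OF g f] less by metis+
  then show ?case by simp
qed

text \<open>Turns \<open>skips_only\<close>, a condition on the set of levels hit, into an explicit
  level function.\<close>

lemma strict_mono_nat_skip_one:
  fixes f :: "nat \<Rightarrow> nat"
  assumes "strict_mono f" "range f = UNIV - {m}"
  shows "f i = (if i < m then i else Suc i)"
proof -
  let ?g = "\<lambda>i. if i < m then i else Suc i"
  have "strict_mono ?g" by (auto simp: strict_mono_def)
  moreover have "range ?g = UNIV - {m}"
  proof -
    have "x \<in> range ?g" if "x \<noteq> m" for x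
    proof (cases "x < m")
      case True then show ?thesis by (intro image_eqI[of _ _ x]) auto
    next
      case False then show ?thesis using that by (intro image_eqI[of _ _ "x - 1"]) auto
    qed
    then show ?thesis by (auto split: if_splits)
  qed
  ultimately show ?thesis using strict_mono_nat_eq_of_range_eq[of f ?g i] assms by simp
qed

lemma finite_class_representatives:
  assumes "finite (f ` D)"
  obtains R where "finite R" "R \<subseteq> D" "\<And>x. x \<in> D \<Longrightarrow> \<exists>y\<in>R. f x = f y"
proof -
  from finite_subset_image[OF assms subset_refl]
  obtain C where "C \<subseteq> D" "finite C" "f ` D = f ` C" by blast
  moreover have "\<exists>y\<in>C. f x = f y" if "x \<in> D" for x
    using \<open>f ` D = f ` C\<close> that by (metis imageE imageI)
  ultimately show thesis using that[of C] by blast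
qed

locale sm_tree =
  fixes T :: "'a set" and le :: "'a \<Rightarrow> 'a \<Rightarrow> bool" and Sig :: "'b set"
    and S :: "'a \<Rightarrow> 'a list \<Rightarrow> 'b \<Rightarrow> 'a option" and M :: "('a \<Rightarrow> 'a) set"
  assumes SM: "SM_tree T le Sig S M"
begin

abbreviation lvl :: "'a \<Rightarrow> nat" where "lvl \<equiv> level T le"
abbreviation lv :: "('a \<Rightarrow> 'a) \<Rightarrow> nat \<Rightarrow> nat" where "lv \<equiv> ftilde T le T"
abbreviation Mfix :: "nat \<Rightarrow> ('a \<Rightarrow> 'a) set" where "Mfix \<equiv> Mn T le M"
abbreviation mcomp :: "('a \<Rightarrow> 'a) \<Rightarrow> ('a \<Rightarrow> 'a) \<Rightarrow> 'a \<Rightarrow> 'a" (infixr "\<Zsemi>" 70)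
  where "F \<Zsemi> G \<equiv> compose T F G"
definition idT :: "'a \<Rightarrow> 'a" where "idT = restrict id T"

lemma idT_apply [simp]: "x \<in> T \<Longrightarrow> idT x = x" by (simp add: idT_def)

lemma S_tree: "S_tree T le Sig S" using SM unfolding SM_tree_def by (rule conjunct1)
lemma is_tree: "is_tree T le" using S_tree unfolding S_tree_def by (rule conjunct1)

lemma le_refl: "a \<in> T \<Longrightarrow> le a a"
  using is_tree unfolding is_tree_def by blast
lemma le_antisym: "a \<in> T \<Longrightarrow> b \<in> T \<Longrightarrow> le a b \<Longrightarrow> le b a \<Longrightarrow> a = b"
  using is_tree unfolding is_tree_def by blast
lemma le_trans: "a \<in> T \<Longrightarrow> b \<in> T \<Longrightarrow> c \<in> T \<Longrightarrow> le a b \<Longrightarrow> le b c \<Longrightarrow> le a c"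
  using is_tree unfolding is_tree_def by blast
lemma finite_below: "a \<in> T \<Longrightarrow> finite {b\<in>T. tlt le b a}"
  using is_tree unfolding is_tree_def by blast
lemma le_linear_below:
  assumes "a \<in> T" "b \<in> T" "c \<in> T" "le b a" "le c a"
  shows "le b c \<or> le c b"
proof (cases "b = a \<or> c = a")
  case True then show ?thesis using assms by blast
next
  case False
  then have "b \<in> {b\<in>T. tlt le b a}" "c \<in> {b\<in>T. tlt le b a}"
    using assms by (auto simp: tlt_def)
  then show ?thesis using is_tree \<open>a \<in> T\<close> unfolding is_tree_def by blast
qed

lemma lvl_less:
  assumes "a \<in> T" "b \<in> T" "tlt le a b"
  shows "lvl a < lvl b"
proof -
  have "{c\<in>T. tlt le c a} \<subseteq> {c\<in>T. tlt le c b}"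
    using assms le_trans le_antisym unfolding tlt_def by blast
  moreover have "a \<in> {c\<in>T. tlt le c b}" "a \<notin> {c\<in>T. tlt le c a}"
    using assms by (auto simp: tlt_def)
  ultimately have "{c\<in>T. tlt le c a} \<subset> {c\<in>T. tlt le c b}" by blast
  then show ?thesis
    unfolding level_def by (rule psubset_card_mono[OF finite_below[OF assms(2)]])
qed

lemma lvl_mono: "a \<in> T \<Longrightarrow> b \<in> T \<Longrightarrow> le a b \<Longrightarrow> lvl a \<le> lvl b"
  using lvl_less[of a b] by (cases "a = b") (auto simp: tlt_def)

lemma eq_of_le_lvl: "a \<in> T \<Longrightarrow> b \<in> T \<Longrightarrow> le a b \<Longrightarrow> lvl b \<le> lvl a \<Longrightarrow> a = b"
  using lvl_less[of a b] by (auto simp: tlt_def)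

lemma le_of_lvl_le:
  assumes "a \<in> T" "b \<in> T" "c \<in> T" "le a c" "le b c" "lvl a \<le> lvl b"
  shows "le a b"
  using le_linear_below[of c a b] eq_of_le_lvl[of b a] assms le_refl by auto

lemma imm_succ_lvl:
  assumes "imm_succ T le a b"
  shows "lvl b = Suc (lvl a)"
proof -
  have ab: "a \<in> T" "b \<in> T" "le a b" "a \<noteq> b" and no: "\<not> (\<exists>c\<in>T. tlt le a c \<and> tlt le c b)"
    using assms by (auto simp: imm_succ_def tlt_def)
  have "{c\<in>T. tlt le c b} = insert a {c\<in>T. tlt le c a}"
  proof
    show "{c\<in>T. tlt le c b} \<subseteq> insert a {c\<in>T. tlt le c a}"
    proof
      fix c assume "c \<in> {c\<in>T. tlt le c b}"
      then have c: "c \<in> T" "le c b" "c \<noteq> b" by (auto simp: tlt_def)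
      then have "le c a \<or> le a c" using le_linear_below[of b c a] ab by blast
      then show "c \<in> insert a {c\<in>T. tlt le c a}" using c no by (auto simp: tlt_def)
    qed
    show "insert a {c\<in>T. tlt le c a} \<subseteq> {c\<in>T. tlt le c b}"
      using ab le_trans le_antisym unfolding tlt_def by blast
  qed
  moreover have "a \<notin> {c\<in>T. tlt le c a}" by (simp add: tlt_def)
  ultimately show ?thesis
    using finite_below[OF ab(1)] by (simp add: level_def)
qed

lemma imm_pred_exists:
  assumes "b \<in> T" "lvl b > 0"
  shows "\<exists>a. imm_succ T le a b"
proof -
  let ?B = "{c\<in>T. tlt le c b}"
  have fin: "finite ?B" by (rule finite_below[OF assms(1)])
  have "?B \<noteq> {}" using assms(2) by (auto simp: level_def card_gt_0_iff)
  then obtain a where a: "a \<in> ?B" and mx: "\<And>c. c \<in> ?B \<Longrightarrow> lvl c \<le> lvl a"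
    using Max_in[of "lvl ` ?B"] Max_ge[of "lvl ` ?B"] fin by fastforce
  have "\<not> (\<exists>c\<in>T. tlt le a c \<and> tlt le c b)"
  proof
    assume "\<exists>c\<in>T. tlt le a c \<and> tlt le c b"
    then obtain c where "c \<in> T" "tlt le a c" "tlt le c b" by blast
    then show False using mx[of c] lvl_less[of a c] a by simp
  qed
  then show ?thesis using a assms(1) unfolding imm_succ_def by blast
qed

lemma S_closed:
  assumes "S a p c = Some x"
  shows "a \<in> T" "set p \<subseteq> T" "x \<in> T" "le a x" "lvl x = Suc (lvl a)"
    "\<And>q. q \<in> set p \<Longrightarrow> lvl q < lvl a"
proof -
  have *: "a \<in> T \<and> set p \<subseteq> T \<and> c \<in> Sig \<and> x \<in> T" "imm_succ T le a x"
    and "\<forall>q\<in>set p. lvl q + 1 \<le> lvl a"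
    using S_tree assms unfolding S_tree_def by blast+
  then show "a \<in> T" "set p \<subseteq> T" "x \<in> T" "\<And>q. q \<in> set p \<Longrightarrow> lvl q < lvl a" by fastforce+
  show "le a x" "lvl x = Suc (lvl a)"
    using * imm_succ_lvl by (auto simp: imm_succ_def tlt_def)
qed

lemma S_exists:
  assumes "b \<in> T" "lvl b = Suc i"
  obtains a p c where "S a p c = Some b" "a \<in> T" "lvl a = i"
proof -
  obtain a where a: "imm_succ T le a b" using imm_pred_exists[of b] assms by auto
  then have "a \<in> T" by (simp add: imm_succ_def)
  moreover have "\<forall>a\<in>T. \<forall>b. imm_succ T le a b \<longrightarrow> (\<exists>p c. set p \<subseteq> T \<and> c \<in> Sig \<and> S a p c = Some b)"
    using S_tree unfolding S_tree_def by blast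
  ultimately obtain p c where "S a p c = Some b" using a by blast
  then show thesis using that[of a p c] S_closed(5)[of a p c b] assms \<open>a \<in> T\<close> by simp
qed

lemma Tlt_iff: "x \<in> Tlt T le q \<longleftrightarrow> x \<in> T \<and> lvl x < q" by (simp add: Tlt_def)
lemma Tlev_iff: "x \<in> Tlev T le q \<longleftrightarrow> x \<in> T \<and> lvl x = q" by (simp add: Tlev_def)

lemma finite_imm_succ: "a \<in> T \<Longrightarrow> finite {b. imm_succ T le a b}"
  using S_tree unfolding S_tree_def by (elim conjE) simp

lemma finite_Tlev: "finite (Tlev T le n)"
proof (induction n)
  case 0
  show ?case using S_tree unfolding S_tree_def by blast
next
  case (Suc n)
  have "Tlev T le (Suc n) \<subseteq> (\<Union>a\<in>Tlev T le n. {b. imm_succ T le a b})"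
  proof
    fix b assume "b \<in> Tlev T le (Suc n)"
    then have b: "b \<in> T" "lvl b = Suc n" by (auto simp: Tlev_iff)
    then obtain a where a: "imm_succ T le a b" using imm_pred_exists[of b] by auto
    then show "b \<in> (\<Union>a\<in>Tlev T le n. {b. imm_succ T le a b})"
      using imm_succ_lvl[OF a] b by (auto simp: Tlev_iff imm_succ_def)
  qed
  moreover have "finite (\<Union>a\<in>Tlev T le n. {b. imm_succ T le a b})"
    using Suc finite_imm_succ by (auto simp: Tlev_iff)
  ultimately show ?case by (rule finite_subset)
qed

lemma finite_Tlt: "finite (Tlt T le q)"
proof -
  have "Tlt T le q = (\<Union>i<q. Tlev T le i)" by (auto simp: Tlt_iff Tlev_iff)
  then show ?thesis using finite_Tlev by simp
qed

section \<open>The axioms on \<open>M\<close> and the level functions\<close>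

lemma M_shape_ext: "\<forall>F\<in>M. shape_preserving T le S F \<and> F \<in> extensional T"
  and id_M: "idT \<in> M"
  and M_comp_closed: "\<forall>F\<in>M. \<forall>G\<in>M. G \<Zsemi> F \<in> M"
  and M1_limit: "\<forall>Fs :: nat \<Rightarrow> 'a \<Rightarrow> 'a. (\<forall>i. Fs i \<in> M) \<longrightarrow>
        (\<forall>i. \<forall>x\<in>Tle T le i. Fs i x = Fs (Suc i) x) \<longrightarrow>
        (\<exists>F\<in>M. \<forall>i. \<forall>x\<in>Tle T le i. F x = Fs i x)"
  and M2: "\<forall>n. \<forall>F\<in>M. Tlev T le n \<noteq> {} \<longrightarrow> lv F n > 0 \<longrightarrow>
        skips T le F (lv F n - 1) \<longrightarrow>
        (\<exists>F1\<in>M. \<exists>F2\<in>M. skips_only T le F2 (lv F n - 1) \<and>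
            (\<forall>x\<in>Tle T le n. F2 (F1 x) = F x))"
  and M3: "\<forall>n m. n < m \<longrightarrow>
        (\<exists>F\<in>M. skips_only T le F m \<and>
           (\<forall>a\<in>Tlev T le n. \<forall>b\<in>Tlev T le m. \<forall>p c x.
              S a p c = Some x \<and> le x b \<longrightarrow> S b p c = Some (F b)))"
  using SM unfolding SM_tree_def idT_def by - (elim conjE, assumption)+

lemma M_shape: "F \<in> M \<Longrightarrow> shape_preserving T le S F"
  and M_ext: "F \<in> M \<Longrightarrow> F \<in> extensional T"
  and comp_M: "F \<in> M \<Longrightarrow> G \<in> M \<Longrightarrow> F \<Zsemi> G \<in> M"
  using M_shape_ext M_comp_closed by simp_all

lemma M_in: "F \<in> M \<Longrightarrow> x \<in> T \<Longrightarrow> F x \<in> T"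
  and M_inj: "F \<in> M \<Longrightarrow> inj_on F T"
  and M_S: "F \<in> M \<Longrightarrow> S a p c = Some x \<Longrightarrow> \<exists>y. S (F a) (map F p) c = Some y \<and> le y (F x)"
  and M_root: "F \<in> M \<Longrightarrow> a \<in> T \<Longrightarrow> lvl a = 0 \<Longrightarrow> b \<in> T \<Longrightarrow> le a b \<Longrightarrow> le a (F b)"
  using M_shape[of F] by (simp_all add: shape_preserving_def Tlev_def Pi_iff)

text \<open>That the tree is infinite is forced by (M3): a map skipping only level 1 has infinitely
  many levels in its image, hence infinitely many levels are nonempty, and predecessors fill the
  levels in between.\<close>

lemma Tlev_nonempty: "Tlev T le n \<noteq> {}"
proof -
  have down: "Tlev T le i \<noteq> {}" if "Tlev T le (i + j) \<noteq> {}" for i j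
    using that
  proof (induction j)
    case (Suc j)
    then obtain b where "b \<in> T" "lvl b = Suc (i + j)" by (auto simp: Tlev_iff)
    then obtain a where "a \<in> T" "lvl a = i + j" using S_exists[of b "i + j"] by blast
    then have "Tlev T le (i + j) \<noteq> {}" unfolding Tlev_def by blast
    then show ?case by (rule Suc.IH)
  qed simp
  obtain F where "F \<in> M" "skips_only T le F 1"
    using M3[rule_format, of 0 1] by auto
  then have "lv F ` {n. Tlev T le n \<noteq> {}} = UNIV - {1}"
    by (simp only: skips_only_def level_image_def setcompr_eq_image)
  moreover have "infinite (UNIV - {1::nat})" by simp
  ultimately have "infinite {n. Tlev T le n \<noteq> {}}" by (metis finite_imageI)
  then obtain N where "N \<ge> n" "Tlev T le N \<noteq> {}"
    unfolding infinite_nat_iff_unbounded_le mem_Collect_eq by blast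
  then show ?thesis using down[of n "N - n"] by simp
qed

lemma level_witness:
  obtains x where "x \<in> T" "lvl x = i"
  using Tlev_nonempty[of i] unfolding Tlev_def by blast

lemma lv_eq:
  assumes "F \<in> M" "x \<in> T"
  shows "lvl (F x) = lv F (lvl x)"
proof -
  have "\<exists>a. a \<in> T \<and> lvl a = lvl x" using assms by blast
  then have *: "(SOME a. a \<in> T \<and> lvl a = lvl x) \<in> T \<and> lvl (SOME a. a \<in> T \<and> lvl a = lvl x) = lvl x"
    by (rule someI_ex)
  have "level_preserving T le T F"
    using M_shape[OF assms(1)] by (simp add: shape_preserving_def)
  then show ?thesis
    using * assms(2) unfolding level_preserving_def ftilde_def by metis
qed

text \<open>The node \<open>S (F a) (map F p) c\<close> lies one level above \<open>F a\<close> and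
  weakly below \<open>F x\<close>.\<close>

lemma lv_strict_mono:
  assumes F: "F \<in> M"
  shows "strict_mono (lv F)"
  unfolding strict_mono_Suc_iff
proof
  fix i
  obtain x where x: "x \<in> T" "lvl x = Suc i" by (rule level_witness)
  then obtain a p c where a: "S a p c = Some x" "a \<in> T" "lvl a = i" using S_exists by blast
  from M_S[OF F a(1)] obtain y where y: "S (F a) (map F p) c = Some y" "le y (F x)" by blast
  have "lvl y = Suc (lvl (F a))" using S_closed(5)[OF y(1)] .
  moreover have "lvl y \<le> lvl (F x)" using lvl_mono S_closed(3)[OF y(1)] M_in[OF F x(1)] y(2) by blast
  ultimately show "lv F i < lv F (Suc i)"
    using lv_eq[OF F] a x by simp
qed

lemma lv_mono: "F \<in> M \<Longrightarrow> i \<le> j \<Longrightarrow> lv F i \<le> lv F j"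
  and lv_less: "F \<in> M \<Longrightarrow> i < j \<Longrightarrow> lv F i < lv F j"
  and lv_ge: "F \<in> M \<Longrightarrow> i \<le> lv F i"
  using lv_strict_mono by (auto simp: strict_mono_less_eq strict_mono_less strict_mono_imp_increasing)

lemma level_image_eq: "level_image T le F = range (lv F)"
  using Tlev_nonempty by (auto simp: level_image_def)

text \<open>Shape preservation speaks of a single application of \<open>S\<close>, so order
  preservation is obtained level by level, by induction on the difference of levels.\<close>

lemma M_le:
  assumes F: "F \<in> M" and "a \<in> T" "b \<in> T" "le a b"
  shows "le (F a) (F b)"
proof -
  have "\<forall>b. b \<in> T \<longrightarrow> le a b \<longrightarrow> lvl b = lvl a + n \<longrightarrow> le (F a) (F b)" for n
  proof (induction n)
    case 0
    show ?case
    proof (intro allI impI)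
      fix b assume "b \<in> T" "le a b" "lvl b = lvl a + 0"
      then have "a = b" using eq_of_le_lvl[OF assms(2)] by simp
      then show "le (F a) (F b)" using le_refl M_in F \<open>b \<in> T\<close> by blast
    qed
  next
    case (Suc n)
    show ?case
    proof (intro allI impI)
      fix b assume b: "b \<in> T" "le a b" "lvl b = lvl a + Suc n"
      then obtain d p c where d: "S d p c = Some b" "d \<in> T" "lvl d = lvl a + n"
        using S_exists[of b "lvl a + n"] by auto
      have "le a d" using le_of_lvl_le[of a d b] assms(2) b d S_closed(4)[OF d(1)] by simp
      then have 1: "le (F a) (F d)" using Suc d by blast
      from M_S[OF F d(1)] obtain y where y: "S (F d) (map F p) c = Some y" "le y (F b)" by blast
      have "le (F d) (F b)"
        using le_trans[of "F d" y "F b"] S_closed(1,3,4)[OF y(1)] y(2) M_in[OF F b(1)] by blast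
      with 1 show "le (F a) (F b)"
        using le_trans M_in[OF F] assms(2) d(2) b(1) by blast
    qed
  qed
  then show ?thesis using assms lvl_mono[of a b] by (metis le_add_diff_inverse)
qed

lemma comp_apply: "x \<in> T \<Longrightarrow> (F \<Zsemi> G) x = F (G x)" by (simp add: compose_eq)

lemma comp_assoc: "H \<in> M \<Longrightarrow> (F \<Zsemi> G) \<Zsemi> H = F \<Zsemi> (G \<Zsemi> H)"
  using M_in by (auto simp: compose_def fun_eq_iff)

lemma comp_id: "F \<in> M \<Longrightarrow> F \<Zsemi> idT = F"
  and id_comp: "F \<in> M \<Longrightarrow> idT \<Zsemi> F = F"
  using M_in M_ext by (fastforce simp: compose_def fun_eq_iff extensional_def)+

lemma lv_comp:
  assumes "F \<in> M" "G \<in> M"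
  shows "lv (F \<Zsemi> G) i = lv F (lv G i)"
proof -
  obtain x where x: "x \<in> T" "lvl x = i" by (rule level_witness)
  then show ?thesis
    using lv_eq[OF comp_M[OF assms] x(1)] lv_eq[OF assms(1) M_in[OF assms(2) x(1)]]
      lv_eq[OF assms(2) x(1)] comp_apply[OF x(1)] by simp
qed

lemma lv_id: "lv idT i = i"
proof -
  obtain x where x: "x \<in> T" "lvl x = i" by (rule level_witness)
  then show ?thesis using lv_eq[OF id_M x(1)] by simp
qed

text \<open>Replaces equality of restrictions to T(<q), so that maps stay total elements of
  \<open>M\<close> and can be composed freely.\<close>

definition agree :: "nat \<Rightarrow> ('a \<Rightarrow> 'a) \<Rightarrow> ('a \<Rightarrow> 'a) \<Rightarrow> bool" where
  "agree q F G \<longleftrightarrow> (\<forall>x\<in>Tlt T le q. F x = G x)"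

lemma agree_refl: "agree q F F"
  and agree_sym: "agree q F G \<Longrightarrow> agree q G F"
  and agree_trans: "agree q F G \<Longrightarrow> agree q G H \<Longrightarrow> agree q F H"
  and agree_mono: "agree q F G \<Longrightarrow> r \<le> q \<Longrightarrow> agree r F G"
  by (auto simp: agree_def Tlt_iff)

lemma agree_iff_restrict: "agree q F G \<longleftrightarrow> restrict F (Tlt T le q) = restrict G (Tlt T le q)"
  unfolding agree_def by (metis restrict_apply' restrict_ext)

lemma agree_SucI:
  assumes "agree q F G" "\<And>b. b \<in> T \<Longrightarrow> lvl b = q \<Longrightarrow> F b = G b"
  shows "agree (Suc q) F G"
  using assms by (auto simp: agree_def Tlt_iff less_Suc_eq)

lemma agree_comp_left: "agree q F G \<Longrightarrow> agree q (H \<Zsemi> F) (H \<Zsemi> G)"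
  by (auto simp: agree_def Tlt_iff comp_apply)

lemma lvl_lv_less:
  assumes "F \<in> M" "x \<in> Tlt T le (Suc q)" "lv F q < r"
  shows "F x \<in> Tlt T le r"
  using assms lv_eq[of F x] M_in[of F x] lv_mono[of F "lvl x" q] by (auto simp: Tlt_iff)

lemma agree_comp_right:
  assumes "agree r F F'" "G \<in> M" "\<And>i. i < q \<Longrightarrow> lv G i < r"
  shows "agree q (F \<Zsemi> G) (F' \<Zsemi> G)"
  using assms lv_eq[of G] M_in[of G] by (auto simp: agree_def Tlt_iff comp_apply)

lemma Mfix_iff: "F \<in> Mfix n \<longleftrightarrow> F \<in> M \<and> agree n F idT"
  by (auto simp: Mn_def agree_def Tlt_iff)

lemma MfixD: "F \<in> Mfix n \<Longrightarrow> F \<in> M" "F \<in> Mfix n \<Longrightarrow> x \<in> T \<Longrightarrow> lvl x < n \<Longrightarrow> F x = x"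
  by (auto simp: Mn_def Tlt_iff)

lemma Mfix_antimono: "m \<le> n \<Longrightarrow> F \<in> Mfix n \<Longrightarrow> F \<in> Mfix m"
  by (auto simp: Mfix_iff agree_mono)

lemma id_Mfix: "idT \<in> Mfix n" by (simp add: Mfix_iff id_M agree_refl)

lemma comp_Mfix: "F \<in> Mfix n \<Longrightarrow> G \<in> Mfix n \<Longrightarrow> F \<Zsemi> G \<in> Mfix n"
  by (auto simp: Mn_def comp_M Tlt_iff comp_apply)

text \<open>The mechanism behind every fusion: a later factor that fixes all levels used so far
  leaves earlier decisions unchanged.\<close>

lemma agree_absorb:
  assumes "F \<in> Mfix r" "G \<in> M" "\<And>i. i < q \<Longrightarrow> lv G i < r"
  shows "agree q (F \<Zsemi> G) G"
  using assms lv_eq[of G] M_in[of G] by (auto simp: Mn_def agree_def Tlt_iff comp_apply)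

lemma agree_absorb_right:
  assumes "G \<in> Mfix q"
  shows "agree q (F \<Zsemi> G) F"
  using assms by (auto simp: Mn_def agree_def Tlt_iff comp_apply)

lemma lv_Mfix: "F \<in> Mfix n \<Longrightarrow> i < n \<Longrightarrow> lv F i = i"
proof -
  assume F: "F \<in> Mfix n" "i < n"
  obtain x where x: "x \<in> T" "lvl x = i" by (rule level_witness)
  then show ?thesis using lv_eq[of F x] F MfixD[of F n] by simp
qed

lemma lv_cong:
  assumes "agree q F G" "F \<in> M" "G \<in> M" "i < q"
  shows "lv F i = lv G i"
proof -
  obtain x where x: "x \<in> T" "lvl x = i" by (rule level_witness)
  then show ?thesis using lv_eq[of F x] lv_eq[of G x] assms by (auto simp: agree_def Tlt_iff)
qed

text \<open>Write \<open>b\<close> as \<open>S a p c\<close>. Since \<open>a\<close> and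
  \<open>p\<close> lie below level \<open>q\<close>, both maps lead to the same node
  \<open>S (F a) (map F p) c\<close>. It is below \<open>G b\<close>, and it is \<open>F b\<close>
  because \<open>F\<close> raises the level by exactly one here. For roots, condition (iii) of shape
  preservation takes over.\<close>

lemma le_image_of_agree:
  assumes "F \<in> M" "G \<in> M" "agree q F G" "b \<in> T" "lvl b = q"
    and "q = 0 \<Longrightarrow> lv F 0 = 0" "\<And>i. q = Suc i \<Longrightarrow> lv F q = Suc (lv F i)"
  shows "le (F b) (G b)"
proof (cases q)
  case 0
  then have "le b (F b)" "le b (G b)" using M_root assms le_refl by auto
  moreover have "b = F b" using eq_of_le_lvl[OF assms(4) M_in[OF assms(1,4)]] \<open>le b (F b)\<close>
      lv_eq[OF assms(1,4)] assms(5,6) 0 by simp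
  ultimately show ?thesis by simp
next
  case (Suc i)
  then obtain a p c where a: "S a p c = Some b" "a \<in> T" "lvl a = i" using S_exists[of b i] assms by auto
  from M_S[OF assms(1) a(1)] obtain y where y: "S (F a) (map F p) c = Some y" "le y (F b)" by blast
  from M_S[OF assms(2) a(1)] obtain z where z: "S (G a) (map G p) c = Some z" "le z (G b)" by blast
  have "F a = G a" using assms(3) a Suc by (auto simp: agree_def Tlt_iff)
  moreover have "map F p = map G p"
    using assms(3) a(3) Suc S_closed(2,6)[OF a(1)] by (force simp: agree_def Tlt_iff)
  ultimately have "y = z" using y(1) z(1) by (metis option.inject)
  have "lvl y = lvl (F b)"
    using S_closed(5)[OF y(1)] lv_eq[OF assms(1)] a assms(4,5) assms(7)[OF Suc] by simp
  then have "y = F b" using eq_of_le_lvl y(2) S_closed(3)[OF y(1)] M_in[OF assms(1,4)] by simp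
  with z \<open>y = z\<close> show ?thesis by simp
qed

text \<open>The identity is the least way to continue itself. Level \<open>n\<close> is included:
  its nodes may move, but only upwards.\<close>

lemma Mfix_ge:
  assumes "F \<in> Mfix n" "x \<in> T" "lvl x \<le> n"
  shows "le x (F x)"
proof -
  have "le (idT x) (F x)"
  proof (rule le_image_of_agree[where q = "lvl x" and F = idT and G = F])
    show "agree (lvl x) idT F" using assms by (auto simp: Mfix_iff intro: agree_sym agree_mono)
    show "F \<in> M" using assms MfixD by blast
  qed (use assms id_M lv_id in auto)
  then show ?thesis using assms by simp
qed

section \<open>Peeling off skipped levels with (M2)\<close>

lemma skips_only_lv:
  assumes "F \<in> M" "skips_only T le F m"
  shows "lv F i = (if i < m then i else Suc i)"
  using strict_mono_nat_skip_one[OF lv_strict_mono[OF assms(1)]] assms(2)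
  by (simp add: skips_only_def level_image_eq)

text \<open>By comparison with the identity each node is below its image, and they have the same
  level.\<close>

lemma Mfix_of_lv_eq:
  assumes "F \<in> M" "\<And>i. i < m \<Longrightarrow> lv F i = i"
  shows "F \<in> Mfix m"
proof -
  have "agree j F idT" if "j \<le> m" for j
    using that
  proof (induction j)
    case 0
    show ?case by (auto simp: agree_def Tlt_iff)
  next
    case (Suc j)
    then have IH: "agree j idT F" by (simp add: agree_sym)
    have "agree (Suc j) idT F"
    proof (rule agree_SucI[OF IH])
      fix b assume b: "b \<in> T" "lvl b = j"
      have "le (idT b) (F b)"
        by (rule le_image_of_agree[OF id_M assms(1) IH]) (use b lv_id in auto)
      then show "idT b = F b"
        using eq_of_le_lvl[of b "F b"] b M_in[OF assms(1)] lv_eq[OF assms(1) b(1)] assms(2)[of j] Suc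
        by simp
    qed
    then show ?case by (rule agree_sym)
  qed
  then show ?thesis using assms by (simp add: Mfix_iff)
qed

lemma skips_only_Mfix: "F \<in> M \<Longrightarrow> skips_only T le F m \<Longrightarrow> F \<in> Mfix m"
  by (rule Mfix_of_lv_eq) (auto simp: skips_only_lv)

text \<open>(M2) says nothing about \<open>F1\<close> alone. Levels below \<open>n\<close> land
  below \<open>m\<close>, where \<open>F2\<close> is the identity, so injectivity of
  \<open>F2\<close> makes \<open>F1\<close> agree with \<open>F\<close> there; and \<open>m\<close>
  is the only level that \<open>F2\<close> takes to \<open>Suc m\<close>.\<close>

lemma M2_split:
  assumes "F \<in> M" "lv F n = Suc m" "\<And>i. i < n \<Longrightarrow> lv F i < m"
  obtains F1 F2 where "F1 \<in> M" "F2 \<in> Mfix m" "skips_only T le F2 m"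
    "agree (Suc n) (F2 \<Zsemi> F1) F" "agree n F1 F" "lv F1 n = m"
proof -
  have "skips T le F m"
  proof -
    have "lv F i \<noteq> m" for i
    proof (cases "i < n")
      case True then show ?thesis using assms(3) by force
    next
      case False
      then have "lv F n \<le> lv F i" using lv_mono[OF assms(1)] by simp
      then show ?thesis using assms(2) by simp
    qed
    then show ?thesis by (auto simp: skips_def level_image_eq)
  qed
  moreover have "lv F n - 1 = m" "lv F n > 0" using assms(2) by simp_all
  ultimately obtain F1 F2 where F: "F1 \<in> M" "F2 \<in> M" "skips_only T le F2 m"
    "\<And>x. x \<in> Tle T le n \<Longrightarrow> F2 (F1 x) = F x"
    using M2[rule_format, OF assms(1) Tlev_nonempty, of n] by auto
  have F2: "F2 \<in> Mfix m" using skips_only_Mfix F by blast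
  have ag: "agree (Suc n) (F2 \<Zsemi> F1) F" using F(4) by (auto simp: agree_def Tlt_iff Tle_def comp_apply)
  have "agree n F1 F"
    unfolding agree_def
  proof
    fix x assume x: "x \<in> Tlt T le n"
    then have *: "x \<in> T" "lvl x < n" by (auto simp: Tlt_iff)
    have "F2 (F1 x) = F x" using F(4) * by (simp add: Tle_def)
    moreover have "F2 (F x) = F x"
      using MfixD(2)[OF F2] M_in[OF assms(1)] lv_eq[OF assms(1)] * assms(3) by simp
    ultimately show "F1 x = F x"
      using inj_onD[OF M_inj[OF F(2)]] M_in[OF assms(1)] M_in[OF F(1)] * by metis
  qed
  moreover have "lv F1 n = m"
  proof -
    have "lv F2 (lv F1 n) = Suc m"
      using lv_cong[OF ag comp_M[OF F(2,1)] assms(1), of n] lv_comp[OF F(2,1)] assms(2) by simp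
    then show ?thesis using skips_only_lv[OF F(2,3)] by (auto split: if_splits)
  qed
  ultimately show thesis using that F F2 ag by blast
qed

text \<open>No level beyond the image of level \<open>q\<close> is skipped. A map matters only on an
  initial part of the tree, so its continuation can be chosen this way; a one-level step before such
  a map then corresponds to a one-level step after it.\<close>

definition tight :: "('a \<Rightarrow> 'a) \<Rightarrow> nat \<Rightarrow> bool" where
  "tight F q \<longleftrightarrow> (\<forall>i. lv F (q + i) = lv F q + i)"

lemma tightD: "tight F q \<Longrightarrow> lv F (q + i) = lv F q + i" by (simp add: tight_def)

lemma tight_mono: "tight F q \<Longrightarrow> q \<le> r \<Longrightarrow> tight F r"
  unfolding tight_def by (metis add.assoc le_add_diff_inverse)

lemma tight_id: "tight idT q" by (simp add: tight_def lv_id)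

lemma tight_comp:
  "F \<in> M \<Longrightarrow> G \<in> M \<Longrightarrow> tight G q \<Longrightarrow> tight F (lv G q) \<Longrightarrow> tight (F \<Zsemi> G) q"
  by (simp add: tight_def lv_comp)

text \<open>Peeling off, with (M2), the last skipped level below the image of level \<open>q\<close> factors \<open>G\<close>
  through \<open>f\<close>.\<close>

lemma factor_through:
  assumes "f \<in> M" "G \<in> M" "agree q f G"
    and "\<And>b. b \<in> T \<Longrightarrow> lvl b = q \<Longrightarrow> le (f b) (G b)"
  shows "\<exists>Y\<in>Mfix (lv f q). tight Y (lv f q) \<and> agree (Suc q) (Y \<Zsemi> f) G"
  using assms(2-)
proof (induction "lv G q" arbitrary: G rule: less_induct)
  case less
  obtain b0 where b0: "b0 \<in> T" "lvl b0 = q" by (rule level_witness)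
  have ge: "lv f q \<le> lv G q"
    using lvl_mono[OF M_in[OF assms(1) b0(1)] M_in[OF less.prems(1) b0(1)]]
      less.prems(3)[OF b0] lv_eq[OF _ b0(1)] assms(1) less.prems(1) b0 by simp
  show ?case
  proof (cases "lv f q = lv G q")
    case True
    have "agree (Suc q) f G"
    proof (rule agree_SucI[OF less.prems(2)])
      fix b assume b: "b \<in> T" "lvl b = q"
      show "f b = G b"
        using eq_of_le_lvl[OF M_in[OF assms(1) b(1)] M_in[OF less.prems(1) b(1)]]
          less.prems(3)[OF b] lv_eq[OF _ b(1)] assms(1) less.prems(1) b True by simp
    qed
    then show ?thesis using id_Mfix tight_id id_comp[OF assms(1)] by metis
  next
    case False
    then obtain m where m: "lv G q = Suc m" "lv f q \<le> m"
      using ge by (metis Suc_le_D Suc_le_eq le_neq_implies_less not_less_eq_eq)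
    have "lv G i < m" if "i < q" for i
      using lv_cong[OF less.prems(2) assms(1) less.prems(1) that] lv_less[OF assms(1) that] m by simp
    then obtain F1 F2 where F: "F1 \<in> M" "F2 \<in> Mfix m" "skips_only T le F2 m"
      "agree (Suc q) (F2 \<Zsemi> F1) G" "agree q F1 G" "lv F1 q = m"
      using M2_split[OF less.prems(1) m(1)] by blast
    have F2M: "F2 \<in> M" using F(2) MfixD by blast
    have "\<exists>Y\<in>Mfix (lv f q). tight Y (lv f q) \<and> agree (Suc q) (Y \<Zsemi> f) F1"
    proof (rule less.hyps)
      show "lv F1 q < lv G q" using F m by simp
      show "agree q f F1" using agree_trans[OF less.prems(2) agree_sym[OF F(5)]] .
      fix b assume b: "b \<in> T" "lvl b = q"
      have G: "F2 (F1 b) = G b" using F(4) b by (auto simp: agree_def Tlt_iff comp_apply)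
      \<comment> \<open>Both \<open>f b\<close> and \<open>F1 b\<close> lie below
        \<open>G b\<close>, hence on one branch, where levels decide the order.\<close>
      have "le (F1 b) (G b)"
        using Mfix_ge[OF F(2) M_in[OF F(1) b(1)]] lv_eq[OF F(1) b(1)] F(6) b G by simp
      moreover have "lvl (f b) \<le> lvl (F1 b)" using lv_eq[OF _ b(1)] assms(1) F b m by simp
      ultimately show "le (f b) (F1 b)"
        using le_of_lvl_le less.prems(3)[OF b] M_in[OF _ b(1)] assms(1) F(1) less.prems(1) by blast
    qed (fact F(1))
    then obtain Y where Y: "Y \<in> Mfix (lv f q)" "tight Y (lv f q)" "agree (Suc q) (Y \<Zsemi> f) F1" by blast
    have YM: "Y \<in> M" using Y MfixD by blast
    have lvY: "lv Y (lv f q) = m"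
      using lv_cong[OF Y(3) comp_M[OF YM assms(1)] F(1), of q] lv_comp[OF YM assms(1)] F(6) by simp
    have "tight F2 m" by (simp add: tight_def skips_only_lv[OF F2M F(3)])
    then have "tight (F2 \<Zsemi> Y) (lv f q)" using tight_comp[OF F2M YM Y(2)] lvY by simp
    moreover have "F2 \<Zsemi> Y \<in> Mfix (lv f q)"
      using comp_Mfix[OF Mfix_antimono[OF m(2) F(2)] Y(1)] .
    moreover have "agree (Suc q) ((F2 \<Zsemi> Y) \<Zsemi> f) G"
      using agree_trans[OF agree_comp_left[OF Y(3)] F(4)] comp_assoc[OF assms(1)] by simp
    ultimately show ?thesis by blast
  qed
qed

section \<open>Large properties and fusion\<close>

text \<open>Up to agreement on T(\<le>n) these are the elements of AM^n_1(n + k), a finite set.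
  Every element of \<open>Mfix n\<close> lies in one of these sets, so a fusion can treat all of
  them by handling one \<open>k\<close> per stage.\<close>

definition reach :: "nat \<Rightarrow> nat \<Rightarrow> ('a \<Rightarrow> 'a) set" where
  "reach n k = {g \<in> Mfix n. lv g n = n + k}"

lemma reachD: "g \<in> reach n k \<Longrightarrow> g \<in> Mfix n" "g \<in> reach n k \<Longrightarrow> g \<in> M"
  "g \<in> reach n k \<Longrightarrow> lv g n = n + k"
  by (auto simp: reach_def MfixD)

lemma reach_lv: "g \<in> reach n k \<Longrightarrow> i < Suc n \<Longrightarrow> lv g i < Suc (n + k)"
  using lv_mono[of g i n] reachD by force

lemma reach_ex: "g \<in> Mfix n \<Longrightarrow> g \<in> reach n (lv g n - n)"
  using lv_ge[of g n] MfixD by (simp add: reach_def)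

lemma reach_0: "g \<in> reach n 0 \<Longrightarrow> agree (Suc n) g idT"
proof -
  assume g: "g \<in> reach n 0"
  have "g \<in> Mfix (Suc n)"
  proof (rule Mfix_of_lv_eq)
    fix i assume "i < Suc n"
    then show "lv g i = i" using reachD[OF g] lv_Mfix by (cases "i = n") auto
  qed (rule reachD[OF g])
  then show ?thesis by (simp add: Mfix_iff)
qed

lemma Mfix_tighten:
  assumes "g \<in> Mfix n"
  shows "\<exists>g'\<in>Mfix n. tight g' n \<and> agree (Suc n) g' g"
proof -
  have "\<exists>Y\<in>Mfix (lv idT n). tight Y (lv idT n) \<and> agree (Suc n) (Y \<Zsemi> idT) g"
  proof (rule factor_through[OF id_M])
    show "g \<in> M" "agree n idT g" using assms by (auto simp: Mfix_iff agree_sym)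
    show "\<And>b. b \<in> T \<Longrightarrow> lvl b = n \<Longrightarrow> le (idT b) (g b)" using Mfix_ge[OF assms] by simp
  qed
  then show ?thesis by (metis lv_id comp_id MfixD(1))
qed

lemma Mfix_cong: "F \<in> Mfix n \<Longrightarrow> G \<in> M \<Longrightarrow> agree q G F \<Longrightarrow> n \<le> q \<Longrightarrow> G \<in> Mfix n"
  by (meson Mfix_iff agree_mono agree_trans)

text \<open>Splits off the last level climbed: \<open>u\<close> is the factor that skips only level
  \<open>n + k\<close>.\<close>

lemma reach_split:
  assumes g: "g \<in> reach n (Suc k)"
  shows "\<exists>g'\<in>reach n k. \<exists>u\<in>reach (n + k) 1. agree (Suc n) (u \<Zsemi> g') g"
proof -
  have "lv g n = Suc (n + k)" using reachD[OF g] by simp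
  moreover have "lv g i < n + k" if "i < n" for i using lv_Mfix[OF reachD(1)[OF g] that] that by simp
  ultimately obtain F1 F2 where F: "F1 \<in> M" "F2 \<in> Mfix (n + k)" "skips_only T le F2 (n + k)"
    "agree (Suc n) (F2 \<Zsemi> F1) g" "agree n F1 g" "lv F1 n = n + k"
    using M2_split[OF reachD(2)[OF g], of n "n + k"] by blast
  have "F1 \<in> reach n k" using Mfix_cong[OF reachD(1)[OF g] F(1,5)] F(6) by (simp add: reach_def)
  moreover have "F2 \<in> reach (n + k) 1"
    using skips_only_lv[OF MfixD(1)[OF F(2)] F(3)] F(2) by (simp add: reach_def)
  ultimately show ?thesis using F(4) by blast
qed

text \<open>\<open>X \<Zsemi> u\<close> agrees with \<open>X\<close> below level \<open>q\<close>
  and lies above it on level \<open>q\<close>, so it factors through \<open>X\<close>. Tightness of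
  \<open>X\<close> makes the new left factor climb \<open>k\<close> levels as well.\<close>

lemma reach_push:
  assumes X: "X \<in> M" "tight X q" and u: "u \<in> reach q k"
  shows "\<exists>v\<in>reach (lv X q) k. agree (Suc q) (X \<Zsemi> u) (v \<Zsemi> X)"
proof -
  have uM: "u \<in> M" using reachD[OF u] by blast
  have "\<exists>Y\<in>Mfix (lv X q). tight Y (lv X q) \<and> agree (Suc q) (Y \<Zsemi> X) (X \<Zsemi> u)"
  proof (rule factor_through[OF X(1)])
    show "X \<Zsemi> u \<in> M" using comp_M X uM by blast
    show "agree q X (X \<Zsemi> u)" using agree_absorb_right[OF reachD(1)[OF u]] agree_sym by blast
    fix b assume b: "b \<in> T" "lvl b = q"
    then show "le (X b) ((X \<Zsemi> u) b)"
      using M_le[OF X(1) b(1) M_in[OF uM b(1)]] Mfix_ge[OF reachD(1)[OF u] b(1)] by (simp add: comp_apply)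
  qed
  then obtain v where v: "v \<in> Mfix (lv X q)" "agree (Suc q) (v \<Zsemi> X) (X \<Zsemi> u)" by blast
  have "lv v (lv X q) = lv X q + k"
    using lv_cong[OF v(2), of q] MfixD(1)[OF v(1)] X comp_M uM lv_comp tightD[OF X(2)] reachD(3)[OF u]
    by simp
  then show ?thesis using v agree_sym by (auto simp: reach_def)
qed

lemma finite_representatives:
  assumes "D \<subseteq> M" "\<And>g. g \<in> D \<Longrightarrow> lv g q \<le> m"
  obtains R where "finite R" "R \<subseteq> D" "\<And>g. g \<in> D \<Longrightarrow> \<exists>r\<in>R. agree (Suc q) g r"
proof -
  have "(\<lambda>g. restrict g (Tlt T le (Suc q))) ` D \<subseteq> Tlt T le (Suc q) \<rightarrow>\<^sub>E Tlt T le (Suc m)"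
    using assms lvl_lv_less by (fastforce simp: less_Suc_eq_le)
  then have "finite ((\<lambda>g. restrict g (Tlt T le (Suc q))) ` D)"
    using finite_Tlt finite_PiE finite_subset by metis
  from finite_class_representatives[OF this]
  obtain R where "finite R" "R \<subseteq> D"
    "\<And>g. g \<in> D \<Longrightarrow> \<exists>r\<in>R. restrict g (Tlt T le (Suc q)) = restrict r (Tlt T le (Suc q))"
    by blast
  then show thesis using that[of R] by (auto simp: agree_iff_restrict)
qed

definition determined :: "nat \<Rightarrow> (('a \<Rightarrow> 'a) \<Rightarrow> bool) \<Rightarrow> bool" where
  "determined n P \<longleftrightarrow> (\<forall>F G. agree (Suc n) F G \<longrightarrow> P F \<longrightarrow> P G)"

lemma determinedD: "determined n P \<Longrightarrow> agree (Suc n) F G \<Longrightarrow> P F \<longleftrightarrow> P G"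
  unfolding determined_def using agree_sym by blast

definition large :: "nat \<Rightarrow> (('a \<Rightarrow> 'a) \<Rightarrow> bool) \<Rightarrow> bool" where
  "large n P \<longleftrightarrow> (\<forall>F\<in>Mfix n. \<exists>G\<in>Mfix n. P (F \<Zsemi> G))"

lemma large_mono:
  "large n P \<Longrightarrow> (\<And>h. h \<in> Mfix n \<Longrightarrow> P h \<Longrightarrow> Q h) \<Longrightarrow> large n Q"
  unfolding large_def using comp_Mfix by blast

text \<open>If the first colour is not large, some subspace avoids it and is covered by the
  remaining colours; \<open>H\<close> accumulates these subspaces.\<close>

lemma large_of_finite_cover:
  assumes "finite I" "\<forall>h\<in>Mfix N. \<exists>i\<in>I. Q i h"
  shows "\<exists>i\<in>I. \<exists>H\<in>Mfix N. large N (\<lambda>h. Q i (H \<Zsemi> h))"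
  using assms
proof (induction I arbitrary: Q rule: finite_induct)
  case empty
  then show ?case using id_Mfix by blast
next
  case (insert x I)
  show ?case
  proof (cases "large N (Q x)")
    case True
    then have "large N (\<lambda>h. Q x (idT \<Zsemi> h))"
      by (rule large_mono) (simp add: id_comp MfixD)
    then show ?thesis using id_Mfix by blast
  next
    case False
    then obtain F where F: "F \<in> Mfix N" "\<And>G. G \<in> Mfix N \<Longrightarrow> \<not> Q x (F \<Zsemi> G)"
      by (auto simp: large_def)
    have "\<forall>h\<in>Mfix N. \<exists>i\<in>I. Q i (F \<Zsemi> h)"
      using insert.prems F comp_Mfix by blast
    from insert.IH[OF this] obtain i H where i: "i \<in> I" "H \<in> Mfix N"
      "large N (\<lambda>h. Q i (F \<Zsemi> (H \<Zsemi> h)))" by blast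
    have "large N (\<lambda>h. Q i ((F \<Zsemi> H) \<Zsemi> h))"
      using i(3) by (rule large_mono) (simp add: comp_assoc MfixD)
    then show ?thesis using i comp_Mfix[OF F(1) i(2)] by blast
  qed
qed

text \<open>At index \<open>k\<close> the maps cohere on T(<n + k), whereas (M1) asks for T(\<le>k),
  which is one level more if \<open>n = 0\<close>. Shifting the sequence by one repairs
  this.\<close>

lemma M_limit:
  assumes "\<And>k. Fs k \<in> M" "\<And>k. agree (n + k) (Fs (Suc k)) (Fs k)"
  shows "\<exists>Z\<in>M. \<forall>k. agree (n + k) Z (Fs k)"
proof -
  have chain: "agree (n + k) (Fs (k + j)) (Fs k)" for k j
  proof (induction j)
    case (Suc j)
    have "agree (n + k) (Fs (Suc (k + j))) (Fs (k + j))"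
      using assms(2)[of "k + j"] by (rule agree_mono) simp
    then show ?case using Suc agree_trans by simp
  qed (simp add: agree_refl)
  have "\<forall>x\<in>Tle T le i. Fs (Suc i) x = Fs (Suc (Suc i)) x" for i
    using assms(2)[of "Suc i"] by (auto simp: agree_def Tlt_iff Tle_def)
  then obtain Z where Z: "Z \<in> M" "\<And>i x. x \<in> Tle T le i \<Longrightarrow> Z x = Fs (Suc i) x"
    using M1_limit[rule_format, of "\<lambda>i. Fs (Suc i)"] assms(1) by blast
  have "agree (n + k) Z (Fs k)" for k
  proof -
    have "agree (n + k) Z (Fs (k + Suc n))"
      unfolding agree_def
    proof
      fix x assume "x \<in> Tlt T le (n + k)"
      then have "x \<in> Tle T le (n + k)" by (simp add: Tlt_iff Tle_def)
      then show "Z x = Fs (k + Suc n) x" using Z(2)[of x "n + k"] by (simp add: add.commute)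
    qed
    then show ?thesis using chain agree_trans by blast
  qed
  then show ?thesis using Z(1) by blast
qed

text \<open>New factors are inserted in the middle of \<open>H \<Zsemi> X\<close>, so successive composites
  agree on longer and longer initial parts of the tree.\<close>

lemma fusion:
  fixes \<Phi> :: "nat \<Rightarrow> ('a \<Rightarrow> 'a) \<Rightarrow> ('a \<Rightarrow> 'a) \<Rightarrow> bool"
  assumes base: "\<Phi> 0 idT idT"
    and step: "\<And>k H X. H \<in> Mfix n \<Longrightarrow> X \<in> Mfix n \<Longrightarrow> tight X (n + k) \<Longrightarrow> \<Phi> k H X \<Longrightarrow>
      \<exists>H'\<in>Mfix (lv X (n + k)). \<exists>F\<in>Mfix (lv X (n + k)).
        tight F (Suc (lv X (n + k))) \<and> \<Phi> (Suc k) (H \<Zsemi> H') (F \<Zsemi> X)"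
  shows "\<exists>Z\<in>Mfix n. \<forall>k. \<exists>H\<in>Mfix n. \<exists>X\<in>Mfix n. tight X (n + k) \<and> \<Phi> k H X \<and> agree (n + k) Z (H \<Zsemi> X)"
proof -
  define P where "P k s \<longleftrightarrow> fst s \<in> Mfix n \<and> snd s \<in> Mfix n \<and> tight (snd s) (n + k) \<and> \<Phi> k (fst s) (snd s)"
    for k s
  define Q where "Q k s s' \<longleftrightarrow> agree (n + k) (fst s' \<Zsemi> snd s') (fst s \<Zsemi> snd s)" for k s s'
  have "\<exists>f. \<forall>k. P k (f k) \<and> Q k (f k) (f (Suc k))"
  proof (rule dependent_nat_choice)
    show "\<exists>s. P 0 s"
      by (rule exI[of _ "(idT, idT)"]) (simp add: P_def base id_Mfix tight_id)
  next
    fix s k assume "P k s"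
    then obtain H X where s: "s = (H, X)" "H \<in> Mfix n" "X \<in> Mfix n" "tight X (n + k)" "\<Phi> k H X"
      by (cases s) (auto simp: P_def)
    let ?N = "lv X (n + k)"
    obtain H' F where *: "H' \<in> Mfix ?N" "F \<in> Mfix ?N" "tight F (Suc ?N)" "\<Phi> (Suc k) (H \<Zsemi> H') (F \<Zsemi> X)"
      using step[OF s(2-5)] by blast
    have M: "H \<in> M" "X \<in> M" "H' \<in> M" "F \<in> M" using s * MfixD by blast+
    have "n \<le> ?N" using lv_ge[OF M(2), of "n + k"] by simp
    then have fix_n: "H' \<in> Mfix n" "F \<in> Mfix n" using * Mfix_antimono by blast+
    \<comment> \<open>\<open>F\<close> is known to be tight only from one level above
      \<open>lv X (n + k)\<close>. As \<open>X\<close> is tight, level \<open>n + k + 1\<close>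
      lands exactly there.\<close>
    have "tight (F \<Zsemi> X) (n + Suc k)"
    proof (rule tight_comp[OF M(4,2)])
      show "tight X (n + Suc k)" using s(4) by (rule tight_mono) simp
      show "tight F (lv X (n + Suc k))" using *(3) tightD[OF s(4), of 1] by simp
    qed
    moreover have "agree (n + k) ((H \<Zsemi> H') \<Zsemi> (F \<Zsemi> X)) (H \<Zsemi> X)"
    proof -
      have X: "i < n + k \<Longrightarrow> lv X i < ?N" for i using lv_less[OF M(2)] by blast
      have "agree (n + k) (F \<Zsemi> X) X" using agree_absorb[OF *(2) M(2) X] .
      then have "agree (n + k) (H' \<Zsemi> (F \<Zsemi> X)) (H' \<Zsemi> X)" by (rule agree_comp_left)
      moreover have "agree (n + k) (H' \<Zsemi> X) X" using agree_absorb[OF *(1) M(2) X] .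
      ultimately have "agree (n + k) (H \<Zsemi> (H' \<Zsemi> (F \<Zsemi> X))) (H \<Zsemi> X)"
        using agree_trans agree_comp_left by blast
      then show ?thesis using comp_assoc[OF comp_M[OF M(4,2)]] by simp
    qed
    ultimately have "P (Suc k) (H \<Zsemi> H', F \<Zsemi> X) \<and> Q k s (H \<Zsemi> H', F \<Zsemi> X)"
      using s fix_n * comp_Mfix by (simp add: P_def Q_def)
    then show "\<exists>s'. P (Suc k) s' \<and> Q k s s'" by blast
  qed
  then obtain f where f: "\<And>k. P k (f k)" "\<And>k. Q k (f k) (f (Suc k))" by blast
  have fM: "fst (f k) \<Zsemi> snd (f k) \<in> Mfix n" for k using f(1)[of k] comp_Mfix by (simp add: P_def)
  obtain Z where Z: "Z \<in> M" "\<And>k. agree (n + k) Z (fst (f k) \<Zsemi> snd (f k))"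
    using M_limit[of "\<lambda>k. fst (f k) \<Zsemi> snd (f k)" n] fM MfixD(1) f(2) unfolding Q_def by blast
  have "Z \<in> Mfix n" using Mfix_cong[OF fM Z(1) Z(2)[of 0]] by simp
  then show ?thesis using f(1) Z(2) unfolding P_def by blast
qed

text \<open>Here \<open>h\<close> is the part of the limit still to be chosen, above the levels
  placed by \<open>X\<close>; the fusions below keep the set of good \<open>h\<close> large.\<close>

definition good :: "nat \<Rightarrow> (('a \<Rightarrow> 'a) \<Rightarrow> bool) \<Rightarrow> nat \<Rightarrow> ('a \<Rightarrow> 'a) \<Rightarrow> ('a \<Rightarrow> 'a) \<Rightarrow> ('a \<Rightarrow> 'a) \<Rightarrow> bool" where
  "good n P k H X h \<longleftrightarrow> (\<forall>g\<in>reach n k. P (H \<Zsemi> h \<Zsemi> X \<Zsemi> g))"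

lemma agree_good:
  assumes "X \<in> M" "g \<in> reach n k" "agree (Suc (lv X (n + k))) h h'"
  shows "agree (Suc n) (h \<Zsemi> X \<Zsemi> g) (h' \<Zsemi> X \<Zsemi> g)"
proof (rule agree_comp_right[OF assms(3)])
  show "X \<Zsemi> g \<in> M" using assms comp_M reachD by blast
  fix i assume "i < Suc n"
  then have "lv g i \<le> n + k" using reach_lv[OF assms(2), of i] by simp
  then show "lv (X \<Zsemi> g) i < Suc (lv X (n + k))"
    using lv_comp[OF assms(1) reachD(2)[OF assms(2)]] lv_mono[OF assms(1)] by (simp add: less_Suc_eq_le)
qed

lemma determined_good:
  assumes "determined n P" "X \<in> M"
  shows "determined (lv X (n + k)) (good n P k H X)"
  unfolding determined_def good_def
  using agree_good[OF assms(2)] agree_comp_left determinedD[OF assms(1)] by blast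

text \<open>A \<open>g\<close> reaching level \<open>n + k + 1\<close> is some \<open>g'\<close>
  reaching level \<open>n + k\<close> followed by a one-level step. Moved across \<open>X\<close>,
  this step becomes a \<open>u\<close> as in the last hypothesis.\<close>

lemma good_step:
  assumes P: "determined n P" and M: "H \<in> M" "H' \<in> M" "F \<in> M" "X \<in> M" "h \<in> M"
    and X: "tight X (n + k)"
    and u: "\<forall>u\<in>reach (lv X (n + k)) 1. good n P k H X (H' \<Zsemi> h \<Zsemi> F \<Zsemi> u)"
  shows "good n P (Suc k) (H \<Zsemi> H') (F \<Zsemi> X) h"
  unfolding good_def
proof
  fix g assume g: "g \<in> reach n (Suc k)"
  obtain g' w where g': "g' \<in> reach n k" and w: "w \<in> reach (n + k) 1" and gw: "agree (Suc n) (w \<Zsemi> g') g"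
    using reach_split[OF g] by blast
  obtain v where v: "v \<in> reach (lv X (n + k)) 1" and Xv: "agree (Suc (n + k)) (X \<Zsemi> w) (v \<Zsemi> X)"
    using reach_push[OF M(4) X w] by blast
  note M' = M reachD(2)[OF g] reachD(2)[OF g'] reachD(2)[OF w] reachD(2)[OF v]
  have "agree (Suc n) ((X \<Zsemi> w) \<Zsemi> g') ((v \<Zsemi> X) \<Zsemi> g')"
    by (rule agree_comp_right[OF Xv reachD(2)[OF g']]) (rule reach_lv[OF g'])
  then have "agree (Suc n) (X \<Zsemi> w \<Zsemi> g') (v \<Zsemi> X \<Zsemi> g')"
    by (simp only: comp_assoc[OF reachD(2)[OF g']])
  then have "agree (Suc n) (X \<Zsemi> g) (v \<Zsemi> X \<Zsemi> g')"
    by (rule agree_trans[OF agree_sym[OF agree_comp_left[OF gw]]])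
  then have "agree (Suc n) (H \<Zsemi> H' \<Zsemi> h \<Zsemi> F \<Zsemi> X \<Zsemi> g) (H \<Zsemi> H' \<Zsemi> h \<Zsemi> F \<Zsemi> v \<Zsemi> X \<Zsemi> g')"
    by (intro agree_comp_left)
  moreover have "P (H \<Zsemi> H' \<Zsemi> h \<Zsemi> F \<Zsemi> v \<Zsemi> X \<Zsemi> g')"
    using u[rule_format, OF v, unfolded good_def, rule_format, OF g'] M' by (simp add: comp_assoc comp_M)
  ultimately have "P (H \<Zsemi> H' \<Zsemi> h \<Zsemi> F \<Zsemi> X \<Zsemi> g)" using determinedD[OF P] by blast
  then show "P ((H \<Zsemi> H') \<Zsemi> h \<Zsemi> (F \<Zsemi> X) \<Zsemi> g)" using M' by (simp add: comp_assoc comp_M)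
qed

text \<open>Largeness gives each \<open>h\<close> some \<open>g\<close>, without a bound on the
  level reached. If no \<open>k\<close> and \<open>X\<close> gave a uniform bound, the
  counterexamples for all \<open>k\<close> could be fused into a subspace missing \<open>P\<close>.
  With \<open>k\<close> fixed there are only finitely many \<open>g\<close> up to agreement, and
  these can be used as colours.\<close>

lemma large_absorbs_level:
  assumes P: "determined n P" and lP: "large n P"
  shows "\<exists>k. \<exists>X\<in>Mfix n. tight X (n + k) \<and> (\<forall>h\<in>Mfix (lv X (n + k)). \<exists>g\<in>reach n k. P (h \<Zsemi> X \<Zsemi> g))"
proof (rule ccontr)
  assume "\<not> ?thesis"
  then have neg: "\<exists>h\<in>Mfix (lv X (n + k)). \<forall>g\<in>reach n k. \<not> P (h \<Zsemi> X \<Zsemi> g)"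
    if "X \<in> Mfix n" "tight X (n + k)" for k X using that by blast
  \<comment> \<open>Only right factors are accumulated here; pinning \<open>H\<close> to
    \<open>idT\<close> makes the limit agree with \<open>X\<close> itself.\<close>
  define \<Phi> where "\<Phi> k H X \<longleftrightarrow> H = idT \<and> (\<forall>j<k. \<forall>g\<in>reach n j. \<not> P (X \<Zsemi> g))" for k H X
  have "\<exists>Z\<in>Mfix n. \<forall>k. \<exists>H\<in>Mfix n. \<exists>X\<in>Mfix n. tight X (n + k) \<and> \<Phi> k H X \<and> agree (n + k) Z (H \<Zsemi> X)"
  proof (rule fusion)
    show "\<Phi> 0 idT idT" by (simp add: \<Phi>_def)
  next
    fix k H X assume X: "X \<in> Mfix n" "tight X (n + k)" "\<Phi> k H X"
    let ?N = "lv X (n + k)"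
    have XM: "X \<in> M" using X MfixD by blast
    obtain h where h: "h \<in> Mfix ?N" "\<And>g. g \<in> reach n k \<Longrightarrow> \<not> P (h \<Zsemi> X \<Zsemi> g)"
      using neg[OF X(1,2)] by blast
    \<comment> \<open>Only the restriction of \<open>h\<close> to T(\<le>?N) matters to
      \<open>P\<close>, so \<open>h\<close> may be replaced by the tight version that the fusion
      asks for.\<close>
    obtain F where F: "F \<in> Mfix ?N" "tight F ?N" "agree (Suc ?N) F h" using Mfix_tighten[OF h(1)] by blast
    have "\<not> P ((F \<Zsemi> X) \<Zsemi> g)" if "j < Suc k" "g \<in> reach n j" for j g
    proof (cases "j = k")
      case True
      then have g: "g \<in> reach n k" using that by simp
      show ?thesis
        using h(2)[OF g] determinedD[OF P agree_good[OF XM g F(3)]] comp_assoc[OF reachD(2)[OF g]] by simp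
    next
      case False
      then have j: "j < k" using that by simp
      have "agree (n + k) (F \<Zsemi> X) X"
        by (rule agree_absorb[OF F(1) XM]) (rule lv_less[OF XM])
      then have "agree (Suc n) ((F \<Zsemi> X) \<Zsemi> g) (X \<Zsemi> g)"
        by (rule agree_comp_right[OF _ reachD(2)[OF that(2)]]) (use reach_lv[OF that(2)] j in fastforce)
      then show ?thesis using determinedD[OF P] X(3) j that(2) by (simp add: \<Phi>_def)
    qed
    then have "\<Phi> (Suc k) (H \<Zsemi> idT) (F \<Zsemi> X)"
      using X(3) by (simp add: \<Phi>_def comp_id id_M)
    moreover have "tight F (Suc ?N)" using F(2) by (rule tight_mono) simp
    ultimately show "\<exists>H'\<in>Mfix ?N. \<exists>F\<in>Mfix ?N. tight F (Suc ?N) \<and> \<Phi> (Suc k) (H \<Zsemi> H') (F \<Zsemi> X)"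
      using F(1) id_Mfix by blast
  qed
  then obtain Z where Z: "Z \<in> Mfix n"
    "\<And>k. \<exists>H\<in>Mfix n. \<exists>X\<in>Mfix n. tight X (n + k) \<and> \<Phi> k H X \<and> agree (n + k) Z (H \<Zsemi> X)" by blast
  obtain g where g: "g \<in> Mfix n" "P (Z \<Zsemi> g)" using lP Z(1) by (auto simp: large_def)
  define j where "j = lv g n - n"
  have gj: "g \<in> reach n j" using reach_ex[OF g(1)] by (simp add: j_def)
  obtain X where X: "X \<in> Mfix n" "\<forall>i<Suc j. \<forall>g\<in>reach n i. \<not> P (X \<Zsemi> g)" "agree (n + Suc j) Z (idT \<Zsemi> X)"
    using Z(2)[of "Suc j"] by (auto simp: \<Phi>_def)
  have "agree (Suc n) (Z \<Zsemi> g) (X \<Zsemi> g)"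
    by (rule agree_comp_right[OF _ reachD(2)[OF gj]])
      (use X(3) reach_lv[OF gj] id_comp[OF MfixD(1)[OF X(1)]] in auto)
  then show False using X(2) gj g(2) determinedD[OF P] by blast
qed

section \<open>Words as maps\<close>

text \<open>A choice of the map in (M3): it repeats at level \<open>m\<close> the branching that a
  node made at level \<open>i\<close>, with the same data \<open>p\<close>,
  \<open>c\<close>.\<close>

definition copy :: "nat \<Rightarrow> nat \<Rightarrow> 'a \<Rightarrow> 'a" where
  "copy i m = (SOME F. F \<in> M \<and> skips_only T le F m \<and>
     (\<forall>a\<in>Tlev T le i. \<forall>b\<in>Tlev T le m. \<forall>p c x. S a p c = Some x \<and> le x b \<longrightarrow> S b p c = Some (F b)))"

lemma copy_spec:
  assumes "i < m"
  shows "copy i m \<in> M" "skips_only T le (copy i m) m"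
    and "\<And>a b p c x. lvl a = i \<Longrightarrow> b \<in> T \<Longrightarrow> lvl b = m \<Longrightarrow> S a p c = Some x \<Longrightarrow> le x b \<Longrightarrow>
      S b p c = Some (copy i m b)"
proof -
  have "\<exists>F. F \<in> M \<and> skips_only T le F m \<and>
     (\<forall>a\<in>Tlev T le i. \<forall>b\<in>Tlev T le m. \<forall>p c x. S a p c = Some x \<and> le x b \<longrightarrow> S b p c = Some (F b))"
    using M3[rule_format, OF assms] by blast
  from someI_ex[OF this, folded copy_def]
  have *: "copy i m \<in> M" "skips_only T le (copy i m) m" "\<forall>a\<in>Tlev T le i. \<forall>b\<in>Tlev T le m. \<forall>p c x.
      S a p c = Some x \<and> le x b \<longrightarrow> S b p c = Some (copy i m b)" by blast+
  then show "copy i m \<in> M" "skips_only T le (copy i m) m" by auto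
  show "S b p c = Some (copy i m b)"
    if "lvl a = i" "b \<in> T" "lvl b = m" "S a p c = Some x" "le x b" for a b p c x
    using *(3)[rule_format, of a b p c x] that S_closed(1)[OF that(4)] by (simp add: Tlev_iff)
qed

lemma copy_Mfix: "i < m \<Longrightarrow> copy i m \<in> Mfix m"
  by (rule skips_only_Mfix[OF copy_spec(1,2)])

lemma lv_copy: "i < m \<Longrightarrow> lv (copy i m) l = (if l < m then l else Suc l)"
  by (rule skips_only_lv[OF copy_spec(1,2)])

definition prefix :: "('a \<Rightarrow> 'a) list \<Rightarrow> 'a \<Rightarrow> 'a" where
  "prefix ls = foldr (\<lambda>F G. F \<Zsemi> G) ls idT"

text \<open>Words are read from right to left, so that the last letter is the head of the list. The
  letter \<open>Some j\<close> copies the map \<open>ls ! j\<close>, which (M3) can do because every word starts with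
  \<open>prefix ls\<close>, where \<open>ls ! j\<close> acts on level \<open>N + j\<close>. The first variable of a word skips nothing,
  and the later ones copy the first one.\<close>

primrec word_map :: "nat \<Rightarrow> ('a \<Rightarrow> 'a) list \<Rightarrow> nat option list \<Rightarrow> 'a \<Rightarrow> 'a" where
  "word_map N ls [] = prefix ls"
| "word_map N ls (x # w) = (case x of
      Some j \<Rightarrow> copy (N + j) (N + length ls + length w) \<Zsemi> word_map N ls w
    | None \<Rightarrow> if lv (word_map N ls w) N < N + length ls + length w
        then copy (lv (word_map N ls w) N) (N + length ls + length w) \<Zsemi> word_map N ls w
        else word_map N ls w)"

lemma prefix_props:
  assumes "\<And>l. l \<in> set ls \<Longrightarrow> l \<in> reach N 1 \<and> tight l N"
  shows "prefix ls \<in> Mfix N" "lv (prefix ls) (N + i) = N + length ls + i"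
proof -
  have "prefix ls \<in> Mfix N \<and> (\<forall>i. lv (prefix ls) (N + i) = N + length ls + i)"
    using assms
  proof (induction ls)
    case Nil
    show ?case by (simp add: prefix_def id_Mfix lv_id)
  next
    case (Cons l ls)
    then have IH: "prefix ls \<in> Mfix N" "\<And>i. lv (prefix ls) (N + i) = N + (length ls + i)"
      by (auto simp: add.assoc)
    have l: "l \<in> Mfix N" "lv l N = Suc N" "tight l N" using Cons.prems[of l] reachD[of l N 1] by auto
    have "prefix (l # ls) = l \<Zsemi> prefix ls" by (simp add: prefix_def)
    then show ?case
      using comp_Mfix[OF l(1) IH(1)] lv_comp[OF MfixD(1)[OF l(1)] MfixD(1)[OF IH(1)]]
        IH(2) tightD[OF l(3)] l(2) by simp
  qed
  then show "prefix ls \<in> Mfix N" "lv (prefix ls) (N + i) = N + length ls + i" by auto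
qed

text \<open>Each letter \<open>Some j\<close> skips one level, but the first variable skips none.
  Hence a variable word sends level \<open>N + 1\<close> where a constant word of the same length
  sends level \<open>N\<close>, which leaves room for the step substituted for the variable.\<close>

lemma word_map_props:
  assumes ls: "\<And>l. l \<in> set ls \<Longrightarrow> l \<in> reach N 1 \<and> tight l N"
    and "set w \<subseteq> insert None (Some ` {..<length ls})"
  shows "word_map N ls w \<in> Mfix N \<and>
    (None \<notin> set w \<longrightarrow> (\<forall>i. lv (word_map N ls w) (N + i) = N + length ls + length w + i)) \<and>
    (None \<in> set w \<longrightarrow> lv (word_map N ls w) N < N + length ls + length w \<and>
      (\<forall>i. lv (word_map N ls w) (Suc (N + i)) = N + length ls + length w + i)) \<and>
    (\<forall>a\<in>T. lvl a = N \<longrightarrow> le (prefix ls a) (word_map N ls w a))"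
  using assms(2)
proof (induction w)
  case Nil
  show ?case using prefix_props[of ls N] ls le_refl M_in[OF MfixD(1)] by auto
next
  case (Cons x w)
  define m where "m = N + length ls + length w"
  define V where "V = word_map N ls w"
  have IH: "V \<in> Mfix N" "None \<notin> set w \<Longrightarrow> lv V (N + i) = m + i"
    "None \<in> set w \<Longrightarrow> lv V N < m" "None \<in> set w \<Longrightarrow> lv V (Suc (N + i)) = m + i"
    "\<And>a. a \<in> T \<Longrightarrow> lvl a = N \<Longrightarrow> le (prefix ls a) (V a)" for i
    using Cons.IH Cons.prems by (simp_all add: V_def m_def)
  have VM: "V \<in> M" using IH(1) MfixD by blast
  have lvVN: "lv V N \<le> m" using IH(2)[of 0] IH(3) by fastforce
  have step: "copy i m \<Zsemi> V \<in> Mfix N"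
    "None \<notin> set w \<Longrightarrow> lv (copy i m \<Zsemi> V) (N + l) = Suc m + l"
    "None \<in> set w \<Longrightarrow> lv (copy i m \<Zsemi> V) N < Suc m"
    "None \<in> set w \<Longrightarrow> lv (copy i m \<Zsemi> V) (Suc (N + l)) = Suc m + l"
    "\<And>a. a \<in> T \<Longrightarrow> lvl a = N \<Longrightarrow> le (prefix ls a) ((copy i m \<Zsemi> V) a)"
    if "i < m" for i l
  proof -
    show "copy i m \<Zsemi> V \<in> Mfix N"
      using comp_Mfix[OF Mfix_antimono[OF _ copy_Mfix[OF that]] IH(1)] by (simp add: m_def)
    show "None \<notin> set w \<Longrightarrow> lv (copy i m \<Zsemi> V) (N + l) = Suc m + l"
      "None \<in> set w \<Longrightarrow> lv (copy i m \<Zsemi> V) N < Suc m"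
      "None \<in> set w \<Longrightarrow> lv (copy i m \<Zsemi> V) (Suc (N + l)) = Suc m + l"
      using lv_comp[OF copy_spec(1)[OF that] VM] lv_copy[OF that] IH(2-4) by simp_all
    fix a assume a: "a \<in> T" "lvl a = N"
    have V: "V a \<in> T" using M_in[OF VM a(1)] .
    have "le (V a) (copy i m (V a))"
      using Mfix_ge[OF copy_Mfix[OF that] V] lv_eq[OF VM a(1)] a lvVN by simp
    moreover have "prefix ls a \<in> T" using M_in[OF MfixD(1)[OF prefix_props(1)[OF ls]] a(1)] by simp
    ultimately show "le (prefix ls a) ((copy i m \<Zsemi> V) a)"
      using le_trans IH(5)[OF a] V M_in[OF copy_spec(1)[OF that] V] a comp_apply by metis
  qed
  have len: "N + length ls + length (x # w) = Suc m" by (simp add: m_def)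
  show ?case
  proof (cases x)
    case (Some j)
    then have j: "N + j < m" using Cons.prems by (auto simp: m_def)
    have "word_map N ls (x # w) = copy (N + j) m \<Zsemi> V" using Some by (simp add: V_def m_def)
    then show ?thesis unfolding len using step[OF j] Some by auto
  next
    case None
    show ?thesis
    proof (cases "None \<in> set w")
      case True
      then have q: "lv V N < m" using IH(3) by blast
      then have "word_map N ls (x # w) = copy (lv V N) m \<Zsemi> V" using None by (simp add: V_def m_def)
      then show ?thesis unfolding len using step[OF q] None True by auto
    next
      case False
      then have "lv V N = m" using IH(2)[of 0] by simp
      then have "word_map N ls (x # w) = V" using None by (simp add: V_def m_def)
      then show ?thesis unfolding len using IH(2)[OF False, of "Suc i" for i] IH(1,5) None \<open>lv V N = m\<close> by simp
    qed
  qed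
qed

text \<open>Such a map sends a node of level \<open>N\<close> to an immediate successor;
  \<open>p\<close> and \<open>c\<close> are the data that (M3) can repeat higher up.\<close>

lemma reach_letter:
  assumes l: "l \<in> reach N 1" and a: "a \<in> T" "lvl a = N"
  shows "\<exists>p c. S a p c = Some (l a)"
proof -
  have M: "l a \<in> T" using M_in[OF reachD(2)[OF l] a(1)] .
  have "lvl (l a) = Suc N" using lv_eq[OF reachD(2)[OF l] a(1)] reachD(3)[OF l] a by simp
  then obtain a' p c where a': "S a' p c = Some (l a)" "a' \<in> T" "lvl a' = N" using S_exists[OF M] by blast
  have "le a' (l a)" "le a (l a)"
    using S_closed(4)[OF a'(1)] Mfix_ge[OF reachD(1)[OF l] a(1)] a by auto
  then have "le a' a" using le_of_lvl_le[OF a'(2) a(1) M] a' a by simp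
  then have "a' = a" using eq_of_le_lvl[OF a'(2) a(1)] a' a by simp
  then show ?thesis using a' by blast
qed

lemma Mfix_S:
  assumes F: "F \<in> Mfix N" and S: "S a p c = Some x" and "lvl a = N"
  shows "\<exists>y. S (F a) p c = Some y \<and> le y (F x)"
proof -
  have "map F p = p" using MfixD(2)[OF F] S_closed(2,6)[OF S] assms(3) by (intro map_idI) auto
  then show ?thesis using M_S[OF MfixD(1)[OF F] S] by simp
qed

text \<open>Letter \<open>j\<close> branches at level \<open>N\<close>. The \<open>j\<close> letters
  before it in the list act later, and each shifts this branching up by one level; \<open>p\<close>
  and \<open>c\<close> are unchanged because \<open>p\<close> lies below level
  \<open>N\<close>.\<close>

lemma prefix_contains_letter:
  assumes ls: "\<And>l. l \<in> set ls \<Longrightarrow> l \<in> reach N 1 \<and> tight l N"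
    and "j < length ls" and a: "a \<in> T" "lvl a = N" and S: "S a p c = Some ((ls ! j) a)"
  shows "\<exists>a' y. lvl a' = N + j \<and> S a' p c = Some y \<and> le y (prefix ls a)"
  using assms(1,2,5)
proof (induction ls arbitrary: j)
  case (Cons l ls)
  have l: "l \<in> Mfix N" "lv l N = Suc N" "tight l N" using Cons.prems(1)[of l] reachD[of l N 1] by auto
  have lM: "l \<in> M" using l MfixD by blast
  have pre: "prefix ls \<in> Mfix N" by (rule prefix_props) (use Cons.prems in auto)
  then have pM: "prefix ls a \<in> T" using M_in MfixD(1) a by blast
  have eq: "prefix (l # ls) a = l (prefix ls a)" using a by (simp add: prefix_def comp_apply)
  show ?case
  proof (cases j)
    case 0
    have "le (l a) (l (prefix ls a))" using M_le[OF lM a(1) pM] Mfix_ge[OF pre a(1)] a by simp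
    then show ?thesis using 0 Cons.prems(3) a eq by auto
  next
    case (Suc i)
    then obtain a' y where a': "lvl a' = N + i" "S a' p c = Some y" "le y (prefix ls a)"
      using Cons.IH[of i] Cons.prems by auto
    have "map l p = p"
      using MfixD(2)[OF l(1)] S_closed(2,6)[OF Cons.prems(3)] a(2) by (intro map_idI) auto
    then obtain y' where y': "S (l a') p c = Some y'" "le y' (l y)" using M_S[OF lM a'(2)] by auto
    have yT: "y \<in> T" "y' \<in> T" "a' \<in> T" using S_closed[OF a'(2)] S_closed[OF y'(1)] by auto
    have "le (l y) (l (prefix ls a))" using M_le[OF lM yT(1) pM a'(3)] .
    then have "le y' (l (prefix ls a))" using le_trans y'(2) yT M_in[OF lM] pM by blast
    moreover have "lvl (l a') = N + j" using lv_eq[OF lM yT(3)] a'(1) tightD[OF l(3)] l(2) Suc by simp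
    ultimately show ?thesis using y'(1) eq by auto
  qed
qed simp

text \<open>Links substitution in words with composition of maps. If the head is a letter, both
  sides receive the same copy. If it is a variable, both sides are the successor of \<open>b\<close>
  with the data \<open>p\<close>, \<open>c\<close> by which \<open>ls ! j\<close> moves
  \<open>a\<close>.\<close>

lemma word_map_subst:
  assumes ls: "\<And>l. l \<in> set ls \<Longrightarrow> l \<in> reach N 1 \<and> tight l N" and j: "j < length ls"
    and "set w \<subseteq> insert None (Some ` {..<length ls})" "None \<in> set w" and a: "a \<in> T" "lvl a = N"
  shows "word_map N ls w ((ls ! j) a) = word_map N ls (map Some (subst_word j w)) a"
  using assms(3,4)
proof (induction w)
  case (Cons x w)
  define m where "m = N + length ls + length w"
  define V where "V = word_map N ls w"
  define u where "u = map Some (subst_word j w)"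
  define b where "b = word_map N ls u a"
  have u: "set u \<subseteq> insert None (Some ` {..<length ls})" "None \<notin> set u" "length u = length w"
    using Cons.prems(1) j by (auto simp: u_def subst_word_def split: option.splits)
  have wset: "set w \<subseteq> insert None (Some ` {..<length ls})" using Cons.prems(1) by auto
  note V = word_map_props[OF ls wset, folded V_def m_def]
  note U = word_map_props[OF ls u(1), unfolded u(3), folded m_def]
  have VM: "V \<in> M" "word_map N ls u \<in> M" using V U MfixD by blast+
  have l: "ls ! j \<in> reach N 1" using ls j by simp
  have la: "(ls ! j) a \<in> T" using M_in[OF reachD(2)[OF l] a(1)] .
  have b: "b \<in> T" "lvl b = m"
  proof -
    show "b \<in> T" using M_in[OF VM(2) a(1)] by (simp add: b_def)
    have "lv (word_map N ls u) (N + 0) = m + 0" using U u(2) by blast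
    then show "lvl b = m" using lv_eq[OF VM(2) a(1)] a by (simp add: b_def)
  qed
  show ?case
  proof (cases x)
    case (Some i)
    then have "V ((ls ! j) a) = b" using Cons wset by (simp add: V_def b_def u_def)
    then show ?thesis using Some a la u(3)
      by (simp add: subst_word_def comp_apply V_def b_def u_def)
  next
    case None
    obtain p c where p: "S a p c = Some ((ls ! j) a)" using reach_letter[OF l a] by blast
    obtain y where y: "S (V a) p c = Some y" "le y (V ((ls ! j) a))"
      using Mfix_S[OF _ p a(2), of V] V by blast
    obtain a' z where a': "lvl a' = N + j" "S a' p c = Some z" "le z (prefix ls a)"
      using prefix_contains_letter[OF ls j a p] by blast
    have "le (prefix ls a) b" using U a by (simp add: b_def)
    moreover have "prefix ls a \<in> T" using M_in[OF MfixD(1)[OF prefix_props(1)[OF ls]] a(1)] by simp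
    ultimately have "le z b" using le_trans a'(3) S_closed(3)[OF a'(2)] b(1) by blast
    moreover have jm: "N + j < m" using j by (simp add: m_def)
    ultimately have "S b p c = Some (copy (N + j) m b)" using copy_spec(3)[OF jm a'(1) b a'(2)] by blast
    moreover have "word_map N ls (map Some (subst_word j (x # w))) a = copy (N + j) m b"
      using None a u(3) by (simp add: subst_word_def comp_apply b_def u_def m_def)
    moreover have "S b p c = Some (word_map N ls (x # w) ((ls ! j) a))"
    proof (cases "None \<in> set w")
      \<comment> \<open>A later variable: the branch to \<open>b\<close> passes through the
        successor \<open>y\<close> of \<open>V a\<close> with data \<open>p\<close>,
        \<open>c\<close>, and copying from the level of \<open>V a\<close> repeats it.\<close>
      case True
      then have Vb: "V ((ls ! j) a) = b" using Cons wset by (simp add: V_def b_def u_def)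
      have q: "lv V N < m" using V True by blast
      have "lvl (V a) = lv V N" using lv_eq[OF VM(1) a(1)] a by simp
      then have "S b p c = Some (copy (lv V N) m b)"
        using copy_spec(3)[OF q _ b y(1)] y(2) Vb by simp
      moreover have "word_map N ls (x # w) ((ls ! j) a) = copy (lv V N) m b"
        using None q la Vb by (simp add: comp_apply V_def m_def)
      ultimately show ?thesis by simp
    next
      \<comment> \<open>The first variable: \<open>b\<close> is \<open>V a\<close>, and
        \<open>V\<close> sends level \<open>N + 1\<close> directly above level \<open>m\<close>, so
        \<open>V ((ls ! j) a)\<close> is the successor \<open>y\<close> itself.\<close>
      case False
      then have "(Some \<circ> case_option j id) x = x" if "x \<in> set w" for x
        using that by (cases x) auto
      then have "map Some (subst_word j w) = w" unfolding subst_word_def map_map by (rule map_idI)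
      then have ub: "b = V a" by (simp add: b_def u_def V_def)
      have lvV: "lv V (N + i) = m + i" for i using V False by blast
      have "lvl y = lvl (V ((ls ! j) a))"
        using S_closed(5)[OF y(1)] b ub lv_eq[OF VM(1) la] lv_eq[OF reachD(2)[OF l] a(1)] a
          reachD(3)[OF l] lvV[of 1] by simp
      then have "y = V ((ls ! j) a)"
        using eq_of_le_lvl[OF S_closed(3)[OF y(1)] M_in[OF VM(1) la] y(2)] by simp
      moreover have "word_map N ls (x # w) = V" using None lvV[of 0] by (simp add: V_def m_def)
      ultimately show ?thesis using y(1) ub by simp
    qed
    ultimately show ?thesis by simp
  qed
qed simp

text \<open>For a single \<open>h\<close>, Hales--Jewett gives a variable word and a colour, both
  depending on \<open>h\<close>. Such pairs are finite in number, so on some subspace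
  \<open>H\<close> one pair works for a large set of \<open>h\<close>.\<close>

lemma large_of_finite_cover_line:
  assumes I: "finite I" and Q: "\<And>i. i \<in> I \<Longrightarrow> determined N (Q i)" and cov: "\<forall>h\<in>Mfix N. \<exists>i\<in>I. Q i h"
  shows "\<exists>i\<in>I. \<exists>V\<in>Mfix N. \<exists>H\<in>Mfix N. tight V (Suc N) \<and>
    large (lv V (Suc N)) (\<lambda>h. \<forall>u\<in>reach N 1. Q i (H \<Zsemi> h \<Zsemi> V \<Zsemi> u))"
proof -
  \<comment> \<open>The level count of words needs tight letters. Each step has a tight version
    agreeing with it on T(\<le>N), so none is lost.\<close>
  define D where "D = {g \<in> reach N 1. tight g N}"
  have "D \<subseteq> M" "\<And>g. g \<in> D \<Longrightarrow> lv g N \<le> Suc N" by (auto simp: D_def reachD)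
  then obtain R where R: "finite R" "R \<subseteq> D" "\<And>g. g \<in> D \<Longrightarrow> \<exists>r\<in>R. agree (Suc N) g r"
    using finite_representatives[of D N "Suc N"] by blast
  obtain ls where "set ls = R" using finite_list[OF R(1)] by blast
  then have ls: "\<And>l. l \<in> set ls \<Longrightarrow> l \<in> reach N 1 \<and> tight l N" using R(2) by (auto simp: D_def)
  have ls_all: "\<exists>j<length ls. agree (Suc N) u (ls ! j)" if u: "u \<in> reach N 1" for u
  proof -
    obtain u' where u': "u' \<in> Mfix N" "tight u' N" "agree (Suc N) u' u"
      using Mfix_tighten[OF reachD(1)[OF u]] by blast
    then have "u' \<in> D" using lv_cong[OF u'(3) MfixD(1) reachD(2)[OF u], of N N] reachD(3)[OF u]
      by (simp add: D_def reach_def)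
    then obtain r where "r \<in> set ls" "agree (Suc N) u r"
      using R(3) \<open>set ls = R\<close> agree_trans agree_sym u'(3) by blast
    then show ?thesis by (metis in_set_conv_nth)
  qed
  let ?s = "length ls"
  obtain e where e: "bij_betw e I {0..<card I}" using ex_bij_betw_finite_nat[OF I] by blast
  obtain L where L: "\<And>\<chi>. \<chi> ` words ?s L \<subseteq> {..<card I} \<Longrightarrow> \<exists>w\<in>var_words ?s L. \<exists>c. monochromatic ?s \<chi> w c"
    using hales_jewett[where s = ?s and r = "card I"] by blast
  \<comment> \<open>The level to which constant words of length \<open>L\<close> send level
    \<open>N\<close> and variable words send level \<open>N + 1\<close>; the prefix accounts for
    \<open>?s\<close>.\<close>
  let ?N = "N + ?s + L"
  have W: "word_map N ls w \<in> Mfix N" "tight (word_map N ls w) (Suc N)" "lv (word_map N ls w) (Suc N) = ?N"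
    if "w \<in> var_words ?s L" for w
  proof -
    have w: "set w \<subseteq> insert None (Some ` {..<?s})" "None \<in> set w" "length w = L"
      using that by (auto simp: var_words_def)
    note * = word_map_props[OF ls w(1)]
    show "word_map N ls w \<in> Mfix N" using * by blast
    have lvw: "lv (word_map N ls w) (Suc (N + i)) = ?N + i" for i using * w(2,3) by blast
    then show "lv (word_map N ls w) (Suc N) = ?N" by (metis add_0_right)
    then show "tight (word_map N ls w) (Suc N)" using lvw by (simp add: tight_def)
  qed
  have subst: "agree (Suc N) (word_map N ls w \<Zsemi> u) (word_map N ls (map Some (subst_word j w)))"
    if w: "w \<in> var_words ?s L" and u: "u \<in> reach N 1" and j: "j < ?s" "agree (Suc N) u (ls ! j)" for w u j
  proof -
    have w': "set w \<subseteq> insert None (Some ` {..<?s})" "None \<in> set w" using w by (auto simp: var_words_def)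
    have sw: "set (map Some (subst_word j w)) \<subseteq> insert None (Some ` {..<?s})"
      using subst_word_in_words[OF w j(1)] by (auto simp: words_def)
    have "agree (Suc N) (word_map N ls w \<Zsemi> (ls ! j)) (word_map N ls (map Some (subst_word j w)))"
    proof (rule agree_SucI)
      have "word_map N ls w \<Zsemi> (ls ! j) \<in> Mfix N"
        using comp_Mfix[OF W(1)[OF w]] ls j reachD(1) nth_mem by blast
      moreover have "word_map N ls (map Some (subst_word j w)) \<in> Mfix N"
        using word_map_props[OF ls sw] by blast
      ultimately show "agree N (word_map N ls w \<Zsemi> (ls ! j)) (word_map N ls (map Some (subst_word j w)))"
        using Mfix_iff agree_trans agree_sym by blast
      show "(word_map N ls w \<Zsemi> (ls ! j)) b = word_map N ls (map Some (subst_word j w)) b"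
        if "b \<in> T" "lvl b = N" for b
        using word_map_subst[OF ls j(1) w' that] that by (simp add: comp_apply)
    qed
    then show ?thesis using agree_comp_left[OF j(2)] agree_trans by blast
  qed
  have "\<forall>h\<in>Mfix ?N. \<exists>iw\<in>I \<times> var_words ?s L. \<forall>u\<in>reach N 1. Q (fst iw) (h \<Zsemi> word_map N ls (snd iw) \<Zsemi> u)"
  proof
    fix h assume "h \<in> Mfix ?N"
    then have h: "h \<in> Mfix N" using Mfix_antimono[of N ?N h] by simp
    define pick where "pick v = (SOME i. i \<in> I \<and> Q i (h \<Zsemi> word_map N ls (map Some v)))" for v
    have pick: "pick v \<in> I \<and> Q (pick v) (h \<Zsemi> word_map N ls (map Some v))" if "v \<in> words ?s L" for v
    proof -
      have "word_map N ls (map Some v) \<in> Mfix N"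
        using word_map_props[OF ls, where w = "map Some v"] that by (auto simp: words_def)
      then have "\<exists>i. i \<in> I \<and> Q i (h \<Zsemi> word_map N ls (map Some v))" using cov comp_Mfix[OF h] by blast
      then show ?thesis unfolding pick_def by (rule someI_ex)
    qed
    have "(\<lambda>v. e (pick v)) ` words ?s L \<subseteq> {..<card I}" using pick bij_betwE[OF e] by fastforce
    then obtain w c where w: "w \<in> var_words ?s L" "monochromatic ?s (\<lambda>v. e (pick v)) w c"
      using L[of "\<lambda>v. e (pick v)"] by blast
    have "\<exists>i\<in>I. \<forall>j<?s. pick (subst_word j w) = i"
    proof (cases "?s = 0")
      case True
      then show ?thesis using cov id_Mfix by auto
    next
      case False
      have "pick (subst_word j w) = pick (subst_word 0 w)" if "j < ?s" for j
      proof -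
        have "e (pick (subst_word j w)) = e (pick (subst_word 0 w))"
          using w(2) that False by (simp add: monochromatic_def)
        moreover have "pick (subst_word j w) \<in> I" "pick (subst_word 0 w) \<in> I"
          using pick subst_word_in_words[OF w(1)] that False by auto
        ultimately show ?thesis by (rule inj_onD[OF bij_betw_imp_inj_on[OF e]])
      qed
      then show ?thesis using pick subst_word_in_words[OF w(1), of 0] False by blast
    qed
    then obtain i where i: "i \<in> I" "\<And>j. j < ?s \<Longrightarrow> pick (subst_word j w) = i" by blast
    have "Q i (h \<Zsemi> word_map N ls w \<Zsemi> u)" if u: "u \<in> reach N 1" for u
    proof -
      obtain j where j: "j < ?s" "agree (Suc N) u (ls ! j)" using ls_all[OF u] by blast
      have "Q i (h \<Zsemi> word_map N ls (map Some (subst_word j w)))"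
        using pick[OF subst_word_in_words[OF w(1) j(1)]] i(2)[OF j(1)] by simp
      then show ?thesis
        using determinedD[OF Q[OF i(1)] agree_comp_left[OF subst[OF w(1) u j]]] by blast
    qed
    then show "\<exists>iw\<in>I \<times> var_words ?s L. \<forall>u\<in>reach N 1. Q (fst iw) (h \<Zsemi> word_map N ls (snd iw) \<Zsemi> u)"
      using i(1) w(1) by (intro bexI[of _ "(i, w)"]) auto
  qed
  then obtain iw H where iw: "iw \<in> I \<times> var_words ?s L" and H: "H \<in> Mfix ?N"
    and la: "large ?N (\<lambda>h. \<forall>u\<in>reach N 1. Q (fst iw) ((H \<Zsemi> h) \<Zsemi> word_map N ls (snd iw) \<Zsemi> u))"
    using large_of_finite_cover[of "I \<times> var_words ?s L" ?N
        "\<lambda>iw h. \<forall>u\<in>reach N 1. Q (fst iw) (h \<Zsemi> word_map N ls (snd iw) \<Zsemi> u)"]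
      I finite_var_words by blast
  let ?V = "word_map N ls (snd iw)"
  have w: "snd iw \<in> var_words ?s L" "fst iw \<in> I" using iw by auto
  have "large (lv ?V (Suc N)) (\<lambda>h. \<forall>u\<in>reach N 1. Q (fst iw) (H \<Zsemi> h \<Zsemi> ?V \<Zsemi> u))"
    unfolding W(3)[OF w(1)] using la by (rule large_mono) (simp add: comp_assoc comp_M reachD(2) MfixD(1)[OF W(1)[OF w(1)]])
  moreover have "H \<in> Mfix N" using Mfix_antimono[OF _ H, of N] by simp
  ultimately show ?thesis using W(1,2)[OF w(1)] w(2) by blast
qed

section \<open>The pigeonhole principle\<close>

text \<open>The level provided by \<open>large_absorbs_level\<close> makes the possible
  \<open>g\<close> into finitely many colours of \<open>h\<close>. The winning \<open>g\<close> is
  built into \<open>F\<close>: a step \<open>u\<close> before \<open>X \<Zsemi> g\<close> reappears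
  as a step \<open>v\<close> at level \<open>?N\<close>, where the line treats all steps
  alike.\<close>

lemma large_line:
  assumes P: "determined n P" and lP: "large n P"
  shows "\<exists>H\<in>Mfix n. \<exists>F\<in>Mfix n. tight F (Suc n) \<and>
    large (lv F (Suc n)) (\<lambda>h. \<forall>u\<in>reach n 1. P (H \<Zsemi> h \<Zsemi> F \<Zsemi> u))"
proof -
  obtain k X where X: "X \<in> Mfix n" "tight X (n + k)"
    and cov: "\<And>h. h \<in> Mfix (lv X (n + k)) \<Longrightarrow> \<exists>g\<in>reach n k. P (h \<Zsemi> X \<Zsemi> g)"
    using large_absorbs_level[OF P lP] by blast
  let ?N = "lv X (n + k)"
  have XM: "X \<in> M" using X MfixD by blast
  have "reach n k \<subseteq> M" "\<And>g. g \<in> reach n k \<Longrightarrow> lv g n \<le> n + k" using reachD by auto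
  then obtain R where R: "finite R" "R \<subseteq> reach n k" "\<And>g. g \<in> reach n k \<Longrightarrow> \<exists>r\<in>R. agree (Suc n) g r"
    using finite_representatives[of "reach n k" n "n + k"] by blast
  have "\<forall>h\<in>Mfix ?N. \<exists>g\<in>R. P (h \<Zsemi> X \<Zsemi> g)"
    using cov R(3) determinedD[OF P] agree_comp_left by blast
  moreover have "determined ?N (\<lambda>h. P (h \<Zsemi> X \<Zsemi> g))" if "g \<in> R" for g
    unfolding determined_def using agree_good[OF XM, of g n k] determinedD[OF P] R(2) that by blast
  ultimately obtain g V H where g: "g \<in> R" and V: "V \<in> Mfix ?N" "tight V (Suc ?N)" and H: "H \<in> Mfix ?N"
    and la: "large (lv V (Suc ?N)) (\<lambda>h. \<forall>u\<in>reach ?N 1. P ((H \<Zsemi> h \<Zsemi> V \<Zsemi> u) \<Zsemi> X \<Zsemi> g))"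
    using large_of_finite_cover_line[OF R(1), of ?N "\<lambda>g h. P (h \<Zsemi> X \<Zsemi> g)"] by blast
  have gr: "g \<in> reach n k" using g R by blast
  obtain g' where g': "g' \<in> Mfix n" "tight g' n" "agree (Suc n) g' g"
    using Mfix_tighten[OF reachD(1)[OF gr]] by blast
  have M: "g \<in> M" "g' \<in> M" "V \<in> M" "H \<in> M" using gr g' V H MfixD reachD by blast+
  have lvg': "lv g' n = n + k" using lv_cong[OF g'(3) M(2,1)] reachD(3)[OF gr] by simp
  define Y where "Y = X \<Zsemi> g'"
  have YM: "Y \<in> M" using comp_M XM M by (simp add: Y_def)
  have Y: "tight Y n" "lv Y n = ?N"
    using tight_comp[OF XM M(2) g'(2)] X(2) lvg' lv_comp[OF XM M(2)] by (simp_all add: Y_def)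
  have lvY: "lv Y (Suc n) = Suc ?N" using tightD[OF Y(1), of 1] Y(2) by simp
  have nN: "n \<le> ?N" using lv_ge[OF XM, of "n + k"] by simp
  have lvF: "lv (V \<Zsemi> Y) (Suc n) = lv V (Suc ?N)" using lv_comp[OF M(3) YM] lvY by simp
  have "large (lv (V \<Zsemi> Y) (Suc n)) (\<lambda>h. \<forall>u\<in>reach n 1. P (H \<Zsemi> h \<Zsemi> (V \<Zsemi> Y) \<Zsemi> u))"
    unfolding lvF using la
  proof (rule large_mono)
    fix h assume hM: "h \<in> Mfix (lv V (Suc ?N))"
      and h: "\<forall>u\<in>reach ?N 1. P ((H \<Zsemi> h \<Zsemi> V \<Zsemi> u) \<Zsemi> X \<Zsemi> g)"
    have hM': "h \<in> M" using hM MfixD by blast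
    show "\<forall>u\<in>reach n 1. P (H \<Zsemi> h \<Zsemi> (V \<Zsemi> Y) \<Zsemi> u)"
    proof
      fix u assume u: "u \<in> reach n 1"
      obtain v where v: "v \<in> reach ?N 1" "agree (Suc n) (Y \<Zsemi> u) (v \<Zsemi> Y)"
        using reach_push[OF YM Y(1) u] Y(2) by auto
      have "agree (Suc n) (v \<Zsemi> Y) (v \<Zsemi> X \<Zsemi> g)"
        unfolding Y_def by (intro agree_comp_left g'(3))
      then have "agree (Suc n) (Y \<Zsemi> u) (v \<Zsemi> X \<Zsemi> g)" by (rule agree_trans[OF v(2)])
      then have "agree (Suc n) (H \<Zsemi> h \<Zsemi> V \<Zsemi> Y \<Zsemi> u) (H \<Zsemi> h \<Zsemi> V \<Zsemi> v \<Zsemi> X \<Zsemi> g)"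
        by (intro agree_comp_left)
      moreover have "P (H \<Zsemi> h \<Zsemi> V \<Zsemi> v \<Zsemi> X \<Zsemi> g)"
        using h[rule_format, OF v(1)] M hM' XM reachD(2)[OF v(1)] by (simp add: comp_assoc comp_M)
      ultimately show "P (H \<Zsemi> h \<Zsemi> (V \<Zsemi> Y) \<Zsemi> u)"
        using determinedD[OF P] reachD(2)[OF u] YM by (simp add: comp_assoc comp_M)
    qed
  qed
  moreover have "tight (V \<Zsemi> Y) (Suc n)"
    using tight_comp[OF M(3) YM tight_mono[OF Y(1)], of "Suc n"] V(2) lvY by simp
  moreover have "V \<Zsemi> Y \<in> Mfix n" "H \<in> Mfix n"
    using Mfix_antimono[OF nN] V H X g' comp_Mfix by (simp_all add: Y_def)
  ultimately show ?thesis by blast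
qed

lemma large_good_step:
  assumes P: "determined n P" and M: "H \<in> M" "H' \<in> M" "F \<in> M" "X \<in> M" and X: "tight X (n + k)"
    and la: "large (lv F (Suc (lv X (n + k))))
      (\<lambda>h. \<forall>u\<in>reach (lv X (n + k)) 1. good n P k H X (H' \<Zsemi> h \<Zsemi> F \<Zsemi> u))"
  shows "large (lv (F \<Zsemi> X) (n + Suc k)) (good n P (Suc k) (H \<Zsemi> H') (F \<Zsemi> X))"
proof -
  have "lv (F \<Zsemi> X) (n + Suc k) = lv F (Suc (lv X (n + k)))"
    using lv_comp[OF M(3,4)] tightD[OF X, of 1] by simp
  then show ?thesis using la by (auto elim!: large_mono intro!: good_step[OF P M _ X] simp: MfixD)
qed

lemma large_good_0:
  assumes P: "determined n P" and lP: "large n P"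
  shows "large (lv idT (n + 0)) (good n P 0 idT idT)"
proof -
  have "P (idT \<Zsemi> h \<Zsemi> idT \<Zsemi> g)" if "h \<in> Mfix n" "P h" "g \<in> reach n 0" for h g
  proof -
    have "agree (Suc n) (h \<Zsemi> g) (h \<Zsemi> idT)" by (intro agree_comp_left reach_0 that)
    then show ?thesis
      using determinedD[OF P] that MfixD(1)[OF that(1)] reachD(2)[OF that(3)]
      by (simp add: id_comp comp_id comp_M)
  qed
  then show ?thesis using large_mono[OF lP] by (simp add: lv_id good_def)
qed

text \<open>Gains \<open>P (H \<Zsemi> F)\<close> over \<open>large_line\<close>. Fusing lines gives
  a subspace \<open>Z\<close> with a large set of good \<open>h\<close> at every stage. Largeness of
  \<open>P\<close> selects a \<open>t\<close> in it, and the stage after the level of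
  \<open>t\<close> covers all \<open>t \<Zsemi> u\<close>.\<close>

lemma large_line_with_base:
  assumes P: "determined n P" and lP: "large n P"
  shows "\<exists>H\<in>Mfix n. \<exists>F\<in>Mfix n. tight F (Suc n) \<and> P (H \<Zsemi> F) \<and>
    large (lv F (Suc n)) (\<lambda>h. \<forall>u\<in>reach n 1. P (H \<Zsemi> h \<Zsemi> F \<Zsemi> u))"
proof -
  have "\<exists>Z\<in>Mfix n. \<forall>k. \<exists>H\<in>Mfix n. \<exists>X\<in>Mfix n. tight X (n + k) \<and>
    large (lv X (n + k)) (good n P k H X) \<and> agree (n + k) Z (H \<Zsemi> X)"
  proof (rule fusion)
    show "large (lv idT (n + 0)) (good n P 0 idT idT)" by (rule large_good_0[OF P lP])
  next
    fix k H X assume *: "H \<in> Mfix n" "X \<in> Mfix n" "tight X (n + k)" "large (lv X (n + k)) (good n P k H X)"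
    have M: "H \<in> M" "X \<in> M" using * MfixD by blast+
    from large_line[OF determined_good[OF P M(2)] *(4)]
    show "\<exists>H'\<in>Mfix (lv X (n + k)). \<exists>F\<in>Mfix (lv X (n + k)). tight F (Suc (lv X (n + k))) \<and>
      large (lv (F \<Zsemi> X) (n + Suc k)) (good n P (Suc k) (H \<Zsemi> H') (F \<Zsemi> X))"
      using large_good_step[OF P M(1) _ _ M(2) *(3)] MfixD(1) by blast
  qed
  then obtain Z where Z: "Z \<in> Mfix n" "\<And>k. \<exists>H\<in>Mfix n. \<exists>X\<in>Mfix n. tight X (n + k) \<and>
    large (lv X (n + k)) (good n P k H X) \<and> agree (n + k) Z (H \<Zsemi> X)" by blast
  obtain t where t: "t \<in> Mfix n" "P (Z \<Zsemi> t)" using lP Z(1) by (auto simp: large_def)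
  define j where "j = lv t n - n"
  have tj: "t \<in> reach n j" using reach_ex[OF t(1)] by (simp add: j_def)
  \<comment> \<open>Stage \<open>Suc j\<close>, since \<open>t'\<close> sends level \<open>n\<close>
    to \<open>n + j\<close> and, after a one-level step \<open>u\<close>, to
    \<open>n + j + 1\<close>.\<close>
  obtain H X where HX: "H \<in> Mfix n" "X \<in> Mfix n" "tight X (n + Suc j)"
    "large (lv X (n + Suc j)) (good n P (Suc j) H X)" "agree (n + Suc j) Z (H \<Zsemi> X)"
    using Z(2)[of "Suc j"] by blast
  obtain t' where t': "t' \<in> Mfix n" "tight t' n" "agree (Suc n) t' t" using Mfix_tighten[OF t(1)] by blast
  have M: "H \<in> M" "X \<in> M" "t \<in> M" "t' \<in> M" using HX t t' MfixD by blast+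
  have lvt': "lv t' n = n + j" using lv_cong[OF t'(3) M(4,3)] reachD(3)[OF tj] by simp
  then have lvt'': "lv t' (Suc n) = n + Suc j" using tightD[OF t'(2), of 1] by simp
  have "agree (Suc n) (Z \<Zsemi> t) ((H \<Zsemi> X) \<Zsemi> t)"
    by (rule agree_comp_right[OF HX(5) M(3)]) (use reach_lv[OF tj] in simp)
  moreover have "agree (Suc n) ((H \<Zsemi> X) \<Zsemi> t') ((H \<Zsemi> X) \<Zsemi> t)" by (rule agree_comp_left[OF t'(3)])
  ultimately have 1: "P (H \<Zsemi> X \<Zsemi> t')"
    using t(2) determinedD[OF P] comp_assoc[OF M(4)] by metis
  have 2: "tight (X \<Zsemi> t') (Suc n)"
    using tight_comp[OF M(2,4) tight_mono[OF t'(2)], of "Suc n"] lvt'' HX(3) by simp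
  have lvF: "lv (X \<Zsemi> t') (Suc n) = lv X (n + Suc j)" using lv_comp[OF M(2,4)] lvt'' by simp
  have "large (lv (X \<Zsemi> t') (Suc n)) (\<lambda>h. \<forall>u\<in>reach n 1. P (H \<Zsemi> h \<Zsemi> (X \<Zsemi> t') \<Zsemi> u))"
    unfolding lvF using HX(4)
  proof (rule large_mono)
    fix h assume h: "good n P (Suc j) H X h"
    show "\<forall>u\<in>reach n 1. P (H \<Zsemi> h \<Zsemi> (X \<Zsemi> t') \<Zsemi> u)"
    proof
      fix u assume u: "u \<in> reach n 1"
      have "t' \<Zsemi> u \<in> reach n (Suc j)"
        using u t'(1) lvt'' lv_comp[OF M(4) reachD(2)[OF u]] comp_Mfix by (simp add: reach_def)
      then show "P (H \<Zsemi> h \<Zsemi> (X \<Zsemi> t') \<Zsemi> u)"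
        using h reachD(2)[OF u] by (simp add: good_def comp_assoc)
    qed
  qed
  then show ?thesis using 1 2 HX(1) comp_Mfix[OF HX(2) t'(1)] by blast
qed

text \<open>The base point from \<open>large_line_with_base\<close> is good, which settles all
  \<open>g\<close> in \<open>reach n k\<close> once and for all; the large set accompanying it
  carries the fusion to the next level.\<close>

lemma large_contains_subspace:
  assumes P: "determined n P" and lP: "large n P"
  shows "\<exists>Z\<in>Mfix n. \<forall>g\<in>Mfix n. P (Z \<Zsemi> g)"
proof -
  define \<Phi> where "\<Phi> k H X \<longleftrightarrow> large (lv X (n + k)) (good n P k H X) \<and>
    (\<forall>j<k. \<forall>g\<in>reach n j. P (H \<Zsemi> X \<Zsemi> g))" for k H X
  have "\<exists>Z\<in>Mfix n. \<forall>k. \<exists>H\<in>Mfix n. \<exists>X\<in>Mfix n. tight X (n + k) \<and> \<Phi> k H X \<and> agree (n + k) Z (H \<Zsemi> X)"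
  proof (rule fusion)
    show "\<Phi> 0 idT idT" using large_good_0[OF P lP] by (simp add: \<Phi>_def)
  next
    fix k H X assume *: "H \<in> Mfix n" "X \<in> Mfix n" "tight X (n + k)" "\<Phi> k H X"
    let ?N = "lv X (n + k)"
    have M: "H \<in> M" "X \<in> M" using * MfixD by blast+
    have la: "large ?N (good n P k H X)" using *(4) by (simp add: \<Phi>_def)
    obtain H' F where F: "H' \<in> Mfix ?N" "F \<in> Mfix ?N" "tight F (Suc ?N)" "good n P k H X (H' \<Zsemi> F)"
      "large (lv F (Suc ?N)) (\<lambda>h. \<forall>u\<in>reach ?N 1. good n P k H X (H' \<Zsemi> h \<Zsemi> F \<Zsemi> u))"
      using large_line_with_base[OF determined_good[OF P M(2)] la] by blast
    have M': "H' \<in> M" "F \<in> M" using F MfixD by blast+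
    have "P ((H \<Zsemi> H') \<Zsemi> (F \<Zsemi> X) \<Zsemi> g)" if "j < Suc k" "g \<in> reach n j" for j g
    proof (cases "j = k")
      case True
      then have g: "g \<in> reach n k" using that by simp
      show ?thesis
        using F(4)[unfolded good_def, rule_format, OF g] M M' reachD(2)[OF g] by (simp add: comp_assoc comp_M)
    next
      case False
      then have j: "j < k" using that by simp
      have "agree (n + k) (F \<Zsemi> X) X" by (rule agree_absorb[OF F(2) M(2)]) (rule lv_less[OF M(2)])
      then have "agree (n + k) (H' \<Zsemi> F \<Zsemi> X) (H' \<Zsemi> X)" by (rule agree_comp_left)
      moreover have "agree (n + k) (H' \<Zsemi> X) X" by (rule agree_absorb[OF F(1) M(2)]) (rule lv_less[OF M(2)])
      ultimately have "agree (n + k) (H' \<Zsemi> F \<Zsemi> X) X" using agree_trans by blast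
      then have "agree (Suc n) ((H' \<Zsemi> F \<Zsemi> X) \<Zsemi> g) (X \<Zsemi> g)"
        by (rule agree_comp_right[OF _ reachD(2)[OF that(2)]]) (use reach_lv[OF that(2)] j in fastforce)
      then have "agree (Suc n) (H \<Zsemi> (H' \<Zsemi> F \<Zsemi> X) \<Zsemi> g) (H \<Zsemi> X \<Zsemi> g)" by (rule agree_comp_left)
      then show ?thesis
        using determinedD[OF P] *(4) j that(2) M M' reachD(2)[OF that(2)]
        by (simp add: \<Phi>_def comp_assoc comp_M)
    qed
    then have "\<Phi> (Suc k) (H \<Zsemi> H') (F \<Zsemi> X)"
      using large_good_step[OF P M(1) M' M(2) *(3) F(5)] by (simp add: \<Phi>_def)
    then show "\<exists>H'\<in>Mfix ?N. \<exists>F\<in>Mfix ?N. tight F (Suc ?N) \<and> \<Phi> (Suc k) (H \<Zsemi> H') (F \<Zsemi> X)"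
      using F by blast
  qed
  then obtain Z where Z: "Z \<in> Mfix n"
    "\<And>k. \<exists>H\<in>Mfix n. \<exists>X\<in>Mfix n. tight X (n + k) \<and> \<Phi> k H X \<and> agree (n + k) Z (H \<Zsemi> X)" by blast
  have "P (Z \<Zsemi> g)" if g: "g \<in> Mfix n" for g
  proof -
    define j where "j = lv g n - n"
    have gj: "g \<in> reach n j" using reach_ex[OF g] by (simp add: j_def)
    obtain H X where HX: "\<Phi> (Suc j) H X" "agree (n + Suc j) Z (H \<Zsemi> X)" using Z(2) by blast
    have "agree (Suc n) (Z \<Zsemi> g) ((H \<Zsemi> X) \<Zsemi> g)"
      by (rule agree_comp_right[OF HX(2) reachD(2)[OF gj]]) (use reach_lv[OF gj] in simp)
    moreover have "P (H \<Zsemi> X \<Zsemi> g)" using HX(1) gj lessI unfolding \<Phi>_def by blast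
    ultimately show ?thesis using determinedD[OF P] comp_assoc[OF reachD(2)[OF gj]] by simp
  qed
  then show ?thesis using Z(1) by blast
qed

lemma pigeonhole:
  assumes "finite I" "\<And>i. i \<in> I \<Longrightarrow> determined n (Q i)" "\<forall>h\<in>Mfix n. \<exists>i\<in>I. Q i h"
  shows "\<exists>i\<in>I. \<exists>Z\<in>Mfix n. \<forall>g\<in>Mfix n. Q i (Z \<Zsemi> g)"
proof -
  obtain i H where i: "i \<in> I" "H \<in> Mfix n" "large n (\<lambda>h. Q i (H \<Zsemi> h))"
    using large_of_finite_cover[OF assms(1,3)] by blast
  have "determined n (\<lambda>h. Q i (H \<Zsemi> h))"
    unfolding determined_def using determinedD[OF assms(2)[OF i(1)]] agree_comp_left by blast
  from large_contains_subspace[OF this i(3)]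
  obtain Z where Z: "Z \<in> Mfix n" "\<And>g. g \<in> Mfix n \<Longrightarrow> Q i (H \<Zsemi> Z \<Zsemi> g)" by blast
  then have "\<forall>g\<in>Mfix n. Q i ((H \<Zsemi> Z) \<Zsemi> g)" by (simp add: comp_assoc MfixD)
  then show ?thesis using i comp_Mfix[OF i(2) Z(1)] by blast
qed

section \<open>Colourings of several levels\<close>

text \<open>The least continuation of a restriction to T(<q): any other extension lies above it on
  level \<open>q\<close> and so factors through it.\<close>

definition canonical :: "nat \<Rightarrow> ('a \<Rightarrow> 'a) \<Rightarrow> bool" where
  "canonical q f \<longleftrightarrow> f \<in> M \<and> tight f q \<and> (q = 0 \<longrightarrow> lv f 0 = 0) \<and> (\<forall>i. q = Suc i \<longrightarrow> lv f q = Suc (lv f i))"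

lemma canonical_factor:
  assumes "canonical q f" "G \<in> M" "agree q f G"
  shows "\<exists>Y\<in>Mfix (lv f q). tight Y (lv f q) \<and> agree (Suc q) (Y \<Zsemi> f) G"
proof (rule factor_through[OF _ assms(2,3)])
  have "f \<in> M \<and> (q = 0 \<longrightarrow> lv f 0 = 0) \<and> (\<forall>i. q = Suc i \<longrightarrow> lv f q = Suc (lv f i))"
    using assms(1) unfolding canonical_def by (elim conjE) (intro conjI; assumption)
  then have f: "f \<in> M" and f0: "q = 0 \<Longrightarrow> lv f 0 = 0"
    and fS: "\<And>i. q = Suc i \<Longrightarrow> lv f q = Suc (lv f i)" by blast+
  show "f \<in> M" by (rule f)
  show "le (f b) (G b)" if "b \<in> T" "lvl b = q" for b
    by (rule le_image_of_agree[OF f assms(2,3) that f0 fS])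
qed

lemma canonical_exists:
  assumes "F \<in> M"
  shows "\<exists>f. canonical q f \<and> agree q f F"
proof (induction q)
  case 0
  show ?case by (rule exI[of _ idT]) (auto simp: canonical_def id_M tight_id lv_id agree_def Tlt_iff)
next
  case (Suc q)
  then obtain f where f: "canonical q f" "agree q f F" by blast
  then obtain Y where Y: "Y \<in> Mfix (lv f q)" "tight Y (lv f q)" "agree (Suc q) (Y \<Zsemi> f) F"
    using canonical_factor[OF f(1) assms f(2)] by blast
  have M: "Y \<in> M" "f \<in> M" "tight f q" using Y(1) MfixD f by (auto simp: canonical_def)
  have t: "tight (Y \<Zsemi> f) q" by (rule tight_comp[OF M Y(2)])
  then have "canonical (Suc q) (Y \<Zsemi> f)"
    using tight_mono[OF t, of "Suc q"] tightD[OF t, of 1] comp_M[OF M(1,2)] by (simp add: canonical_def)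
  then show ?case using Y(3) by blast
qed

text \<open>For one canonical \<open>s\<close> the pigeonhole principle equalises the colours of its
  extensions. Up to agreement only finitely many \<open>s\<close> send level \<open>n + k\<close> to
  a given level, so a fusion can handle one target level per stage.\<close>

lemma end_homogeneous:
  fixes f :: "('a \<Rightarrow> 'a) \<Rightarrow> 'c"
  assumes f: "\<And>F G. agree (Suc (n + k)) F G \<Longrightarrow> f F = f G" and fin: "finite (f ` Mfix n)"
  shows "\<exists>Z\<in>Mfix n. \<forall>s\<in>Mfix n. canonical (n + k) s \<longrightarrow>
    (\<forall>Y\<in>Mfix (lv s (n + k)). f (Z \<Zsemi> Y \<Zsemi> s) = f (Z \<Zsemi> s))"
proof -
  define C where "C j = {s \<in> Mfix n. canonical (n + k) s \<and> lv s (n + k) = n + j}" for j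
  define \<Phi> where "\<Phi> j H X \<longleftrightarrow> X = idT \<and>
    (\<forall>i<j. \<forall>s\<in>C i. \<exists>c. \<forall>Y\<in>Mfix (n + i). f (H \<Zsemi> Y \<Zsemi> s) = c)" for j H X
  have "\<exists>Z\<in>Mfix n. \<forall>j. \<exists>H\<in>Mfix n. \<exists>X\<in>Mfix n. tight X (n + j) \<and> \<Phi> j H X \<and> agree (n + j) Z (H \<Zsemi> X)"
  proof (rule fusion)
    show "\<Phi> 0 idT idT" by (simp add: \<Phi>_def)
  next
    fix j H X assume *: "H \<in> Mfix n" "X \<in> Mfix n" "tight X (n + j)" "\<Phi> j H X"
    let ?N = "n + j"
    have CM: "C j \<subseteq> M" "\<And>s. s \<in> C j \<Longrightarrow> lv s (n + k) \<le> ?N" by (auto simp: C_def MfixD)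
    obtain R where R: "finite R" "R \<subseteq> C j" "\<And>s. s \<in> C j \<Longrightarrow> \<exists>r\<in>R. agree (Suc (n + k)) s r"
      using finite_representatives[OF CM] by blast
    define Q where "Q c h \<longleftrightarrow> (\<forall>s\<in>R. f (H \<Zsemi> h \<Zsemi> s) = c s)" for c h
    \<comment> \<open>A single pigeonhole applied to vectors of colours indexed by \<open>R\<close>
      treats all representatives together.\<close>
    have "\<exists>c\<in>R \<rightarrow>\<^sub>E f ` Mfix n. \<exists>Z\<in>Mfix ?N. \<forall>g\<in>Mfix ?N. Q c (Z \<Zsemi> g)"
    proof (rule pigeonhole)
      show "finite (R \<rightarrow>\<^sub>E f ` Mfix n)" using R(1) fin by (intro finite_PiE) auto
      show "determined ?N (Q c)" if "c \<in> R \<rightarrow>\<^sub>E f ` Mfix n" for c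
        unfolding determined_def
      proof (intro allI impI)
        fix F G assume FG: "agree (Suc ?N) F G" "Q c F"
        have "f (H \<Zsemi> F \<Zsemi> s) = f (H \<Zsemi> G \<Zsemi> s)" if "s \<in> R" for s
        proof (intro f agree_comp_left agree_comp_right[OF FG(1)])
          have s: "s \<in> C j" using that R(2) by blast
          then show sM: "s \<in> M" using CM by blast
          show "lv s i < Suc ?N" if "i < Suc (n + k)" for i
            using lv_mono[OF sM, of i "n + k"] that CM(2)[OF s] by simp
        qed
        then show "Q c G" using FG(2) by (simp add: Q_def)
      qed
      show "\<forall>h\<in>Mfix ?N. \<exists>c\<in>R \<rightarrow>\<^sub>E f ` Mfix n. Q c h"
      proof
        fix h assume "h \<in> Mfix ?N"
        then have h: "h \<in> Mfix n" using Mfix_antimono[of n ?N h] by simp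
        let ?c = "restrict (\<lambda>s. f (H \<Zsemi> h \<Zsemi> s)) R"
        have "?c \<in> R \<rightarrow>\<^sub>E f ` Mfix n" using *(1) h R(2) comp_Mfix by (auto simp: C_def)
        moreover have "Q ?c h" by (simp add: Q_def)
        ultimately show "\<exists>c\<in>R \<rightarrow>\<^sub>E f ` Mfix n. Q c h" by blast
      qed
    qed
    then obtain c Z where Z: "Z \<in> Mfix ?N" "\<And>g. g \<in> Mfix ?N \<Longrightarrow> Q c (Z \<Zsemi> g)" by blast
    have M: "H \<in> M" "Z \<in> M" using * Z MfixD by blast+
    have new: "\<exists>d. \<forall>Y\<in>Mfix (n + i). f ((H \<Zsemi> Z) \<Zsemi> Y \<Zsemi> s) = d" if i: "i < Suc j" and s: "s \<in> C i" for i s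
    proof -
      have sM: "s \<in> M" using s by (auto simp: C_def dest: MfixD(1))
      have assoc: "(H \<Zsemi> Z) \<Zsemi> Y \<Zsemi> s = H \<Zsemi> (Z \<Zsemi> Y) \<Zsemi> s" if "Y \<in> Mfix (n + i)" for Y
        using sM MfixD(1)[OF that] by (simp add: comp_assoc comp_M)
      show ?thesis
      proof (cases "i = j")
        case True
        then obtain r where r: "r \<in> R" "agree (Suc (n + k)) s r" using R(3) s by blast
        have "f ((H \<Zsemi> Z) \<Zsemi> Y \<Zsemi> s) = c r" if "Y \<in> Mfix (n + i)" for Y
          using f[OF agree_comp_left[OF agree_comp_left[OF r(2)]], of H "Z \<Zsemi> Y"]
            Z(2)[of Y] that True r(1) assoc[OF that] by (simp add: Q_def)
        then show ?thesis by blast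
      next
        case False
        then have "i < j" using i by simp
        then have "Z \<in> Mfix (n + i)" using Mfix_antimono[OF _ Z(1), of "n + i"] by simp
        moreover obtain d where "\<And>Y. Y \<in> Mfix (n + i) \<Longrightarrow> f (H \<Zsemi> Y \<Zsemi> s) = d"
          using *(4) \<open>i < j\<close> s unfolding \<Phi>_def by blast
        ultimately show ?thesis using assoc comp_Mfix by metis
      qed
    qed
    have X: "X = idT" using *(4) by (simp add: \<Phi>_def)
    then have "\<Phi> (Suc j) (H \<Zsemi> Z) (idT \<Zsemi> X)"
      unfolding \<Phi>_def using new by (simp add: comp_id id_M)
    then show "\<exists>H'\<in>Mfix (lv X ?N). \<exists>F\<in>Mfix (lv X ?N). tight F (Suc (lv X ?N)) \<and> \<Phi> (Suc j) (H \<Zsemi> H') (F \<Zsemi> X)"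
      using Z(1) id_Mfix tight_id X lv_id by metis
  qed
  then obtain Z where Z: "Z \<in> Mfix n"
    "\<And>j. \<exists>H\<in>Mfix n. \<exists>X\<in>Mfix n. tight X (n + j) \<and> \<Phi> j H X \<and> agree (n + j) Z (H \<Zsemi> X)" by blast
  have "f (Z \<Zsemi> Y \<Zsemi> s) = f (Z \<Zsemi> s)"
    if s: "s \<in> Mfix n" "canonical (n + k) s" and Y: "Y \<in> Mfix (lv s (n + k))" for s Y
  proof -
    have M: "s \<in> M" "Y \<in> M" using s Y MfixD by blast+
    obtain i where i: "lv s (n + k) = n + i"
      using lv_ge[OF M(1), of "n + k"] by (metis add_leD1 le_Suc_ex)
    \<comment> \<open>Large enough that stage \<open>j\<close> has treated \<open>s\<close> and that
      \<open>Z\<close> agrees with \<open>H\<close> wherever \<open>s\<close> and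
      \<open>Y \<Zsemi> s\<close> send T(\<le>n + k).\<close>
    define j where "j = Suc (i + lv (Y \<Zsemi> s) (n + k))"
    obtain H where H: "H \<in> Mfix n" "\<Phi> j H idT" "agree (n + j) Z (H \<Zsemi> idT)"
      using Z(2)[of j] by (auto simp: \<Phi>_def)
    have ZH: "agree (n + j) Z H" using H(3) comp_id[OF MfixD(1)[OF H(1)]] by simp
    have eq: "f (Z \<Zsemi> G) = f (H \<Zsemi> G)" if "G \<in> M" "lv G (n + k) < n + j" for G
    proof (intro f agree_comp_right[OF ZH that(1)])
      fix l assume "l < Suc (n + k)"
      then show "lv G l < n + j" using lv_mono[OF that(1), of l "n + k"] that(2) by simp
    qed
    have "i < j" "s \<in> C i" using s i by (auto simp: j_def C_def)
    then obtain d where d: "\<And>Y. Y \<in> Mfix (n + i) \<Longrightarrow> f (H \<Zsemi> Y \<Zsemi> s) = d"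
      using H(2) unfolding \<Phi>_def by blast
    have "f (H \<Zsemi> Y \<Zsemi> s) = f (H \<Zsemi> s)"
      using d[of Y] d[OF id_Mfix] Y i id_comp[OF M(1)] by simp
    then show ?thesis using eq[OF comp_M[OF M(2,1)]] eq[OF M(1)] i by (simp add: j_def)
  qed
  then show ?thesis using Z(1) by blast
qed

text \<open>Inside the subspace from \<open>end_homogeneous\<close>, the colour of a map equals that
  of the canonical continuation of its restriction with one level less, to which the induction
  hypothesis applies.\<close>

theorem homogeneous:
  fixes f :: "('a \<Rightarrow> 'a) \<Rightarrow> 'c"
  assumes "\<And>F G. agree (n + k) F G \<Longrightarrow> f F = f G" "finite (f ` Mfix n)"
  shows "\<exists>Z\<in>Mfix n. \<exists>c. \<forall>g\<in>Mfix n. f (Z \<Zsemi> g) = c"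
  using assms
proof (induction k arbitrary: f)
  case 0
  have "f (idT \<Zsemi> g) = f idT" if "g \<in> Mfix n" for g
    using that 0(1)[of g idT] id_comp by (simp add: Mfix_iff)
  then show ?case using id_Mfix by blast
next
  case (Suc k)
  obtain Z where Z: "Z \<in> Mfix n" "\<And>s Y. s \<in> Mfix n \<Longrightarrow> canonical (n + k) s \<Longrightarrow>
      Y \<in> Mfix (lv s (n + k)) \<Longrightarrow> f (Z \<Zsemi> Y \<Zsemi> s) = f (Z \<Zsemi> s)"
    using end_homogeneous[of n k f] Suc.prems by auto
  \<comment> \<open>The choice refers to \<open>g\<close> only through agreement below level
    \<open>n + k\<close>, so maps with equal restrictions get the very same continuation and the new
    colouring is well defined.\<close>
  define can where "can g = (SOME s. canonical (n + k) s \<and> agree (n + k) s g)" for g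
  have can: "canonical (n + k) (can g)" "agree (n + k) (can g) g" "can g \<in> Mfix n" if "g \<in> Mfix n" for g
  proof -
    have *: "canonical (n + k) (can g) \<and> agree (n + k) (can g) g"
      unfolding can_def by (rule someI_ex[OF canonical_exists[OF MfixD(1)[OF that]]])
    then show "canonical (n + k) (can g)" "agree (n + k) (can g) g" by auto
    show "can g \<in> Mfix n" by (rule Mfix_cong[OF that]) (use * in \<open>auto simp: canonical_def\<close>)
  qed
  have "\<exists>Z'\<in>Mfix n. \<exists>c. \<forall>g\<in>Mfix n. f (Z \<Zsemi> can (Z' \<Zsemi> g)) = c"
  proof (rule Suc.IH)
    fix F G assume FG: "agree (n + k) F G"
    have "agree (n + k) s F \<longleftrightarrow> agree (n + k) s G" for s using FG agree_trans agree_sym by blast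
    then show "f (Z \<Zsemi> can F) = f (Z \<Zsemi> can G)" by (simp add: can_def)
  next
    have "(\<lambda>g. f (Z \<Zsemi> can g)) ` Mfix n \<subseteq> f ` Mfix n" using comp_Mfix[OF Z(1)] can(3) by blast
    then show "finite ((\<lambda>g. f (Z \<Zsemi> can g)) ` Mfix n)" using Suc.prems(2) finite_subset by blast
  qed
  then obtain Z' c where Z': "Z' \<in> Mfix n" "\<And>g. g \<in> Mfix n \<Longrightarrow> f (Z \<Zsemi> can (Z' \<Zsemi> g)) = c" by blast
  have "f ((Z \<Zsemi> Z') \<Zsemi> g) = c" if g: "g \<in> Mfix n" for g
  proof -
    let ?G = "Z' \<Zsemi> g"
    have G: "?G \<in> Mfix n" by (rule comp_Mfix[OF Z'(1) g])
    obtain Y where Y: "Y \<in> Mfix (lv (can ?G) (n + k))" "agree (Suc (n + k)) (Y \<Zsemi> can ?G) ?G"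
      using canonical_factor[OF can(1)[OF G] MfixD(1)[OF G] can(2)[OF G]] by blast
    have "f (Z \<Zsemi> ?G) = f (Z \<Zsemi> Y \<Zsemi> can ?G)"
      using Suc.prems(1)[of "Z \<Zsemi> Y \<Zsemi> can ?G" "Z \<Zsemi> ?G"] agree_comp_left[OF Y(2)] by simp
    also have "\<dots> = c" using Z(2)[OF can(3)[OF G] can(1)[OF G] Y(1)] Z'(2)[OF g] by simp
    finally show ?thesis using comp_assoc[OF MfixD(1)[OF g]] by simp
  qed
  then show ?case using comp_Mfix[OF Z(1) Z'(1)] by blast
qed

end

theorem mainTheorem1:
  fixes T :: "'a set" and le :: "'a \<Rightarrow> 'a \<Rightarrow> bool" and Sig :: "'b set"
    and S :: "'a \<Rightarrow> 'a list \<Rightarrow> 'b \<Rightarrow> 'a option" and M :: "('a \<Rightarrow> 'a) set"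
    and n k :: nat and \<chi> :: "('a \<Rightarrow> 'a) \<Rightarrow> 'c"
  assumes "SM_tree T le Sig S M"
    and "finite (\<chi> ` AMnk T le M n k)"
  shows "\<exists>F\<in>Mn T le M n. \<exists>c. \<forall>g\<in>AMnk T le M n k.
           \<chi> (restrict (F \<circ> g) (Tlt T le (n + k))) = c"
proof -
  interpret sm_tree T le Sig S M using assms(1) by unfold_locales
  let ?r = "\<lambda>F. restrict F (Tlt T le (n + k))"
  have "\<exists>Z\<in>Mn T le M n. \<exists>c. \<forall>g\<in>Mn T le M n. \<chi> (?r (compose T Z g)) = c"
  proof (rule homogeneous[where f = "\<lambda>F. \<chi> (?r F)"])
    show "\<chi> (?r F) = \<chi> (?r G)" if "agree (n + k) F G" for F G
      using that by (simp add: agree_iff_restrict)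
    show "finite ((\<lambda>F. \<chi> (?r F)) ` Mn T le M n)"
      using assms(2) by (simp add: AMnk_def image_image)
  qed
  then obtain Z c where Z: "Z \<in> Mn T le M n" "\<And>g. g \<in> Mn T le M n \<Longrightarrow> \<chi> (?r (compose T Z g)) = c"
    by blast
  \<comment> \<open>The inner restriction makes \<open>g\<close> undefined from level
    \<open>n + k\<close> on; the outer one discards those values.\<close>
  have "?r (Z \<circ> ?r g) = ?r (compose T Z g)" for g
    by (auto simp: fun_eq_iff compose_def Tlt_iff)
  then show ?thesis using Z unfolding AMnk_def by (intro bexI[of _ Z] exI[of _ c]) auto
qed

end
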